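(* Let $\mathcal{V}\subseteq\mathcal{V}_{\mathrm{all}}$ be a nonempty set of index pairs fixed in advance (independently of the data). Let $c^0$ be an outcome of $K$-means with $\mathbb{P}(\mathcal{C}(X)=c^0)>0$ in which all $K$ clusters are nonempty at every step, let $\mathcal{C}_1,\dots,\mathcal{C}_K$ be the final clusters determined by $c^0$, and suppose that the null hypothesis $H_{0,\mathcal{V}}$ holds for these clusters, i.e. $\bar\mu_{\mathcal{C}_k}=\bar\mu_{\mathcal{C}_{k'}}$ for all $(k,k')\in\mathcal{V}$. Let $Q_\sigma$ be the conditional CDF of $T_\sigma=\|P_{\mathcal{E}}X\|_F/\sigma$ given $\mathcal{C}(X)=c^0$ and $Z=\left(\frac{P_{\mathcal{E}}X}{\|P_{\mathcal{E}}X\|_F},\,P_{\mathcal{E}}^{\perp}X\right)$. Then (almost surely, given $\mathcal{C}(X)=c^0$) $$Q_\sigma=F_{\chi_d}(\,\cdot\,;\mathcal{S}_\sigma),$$ where $d=q\cdot\dim(\mathcal{E})$ and $F_{\chi_d}(\cdot;\mathcal{S}_\sigma)$ is the CDF of the $\chi_d$ distribution truncated to the set $$\mathcal{S}_\sigma=\{\psi\ge 0:\ \mathcal{C}(X)=\mathcal{C}(x_\sigma(\psi))\},\qquad x_\sigma(\psi)=\psi\cdot\frac{\sigma P_{\mathcal{E}}X}{\|P_{\mathcal{E}}X\|_F}+P_{\mathcal{E}}^{\perp}X .$$ Furthermore, with $p_\sigma=1-Q_\sigma(T_\sigma)$, for every $\alpha\in(0,1)$, $\mathbb{P}(p_\s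igma\le\alpha\mid\mathcal{C}(X)=c^0)=\alpha$.
   Context: Write $[m]=\{1,\dots,m\}$. For a matrix $A$, $A_i$ is its $i$th row and $\|A\|_F$ its Frobenius norm. Let $n,q,K,J$ be positive integers with $2\le K\le n$, let $\sigma>0$ (known), and let $\mu\in\mathbb{R}^{n\times q}$ be a fixed matrix with rows $\mu_1,\dots,\mu_n$. $X\in\mathbb{R}^{n\times q}$ is a random matrix with independent rows $X_i\sim\mathcal{N}(\mu_i,\sigma^2I_q)$. $K$-means (Lloyd's algorithm) run on the rows of $A\in\mathbb{R}^{n\times q}$ for $J$ iterations: the initial centers $m^{(0)}_1(A),\dots,m^{(0)}_K(A)$ are $K$ rows of $A$ with distinct indices fixed independently of the data; $c_i^{(0)}(A)\in[K]$ is the index of the initial center nearest (in $\ell_2$ norm) to $A_i$; for $j\in[J]$, the $l$th center is recomputed as the average of the rows $A_s$ with $c_s^{(j-1)}(A)=l$, and $c_i^{(j)}(A)$ is the index of the recomputed center nearest to $A_i$ (ties broken by a fixed rule). The outcome is $\mathcal{C}(A)=(c_i^{(j)}(A))_{i\in[n],\,0\le j\le J}$, the cluster assignments at every step. It is assumed that the algorithm has $K$ nonempty clusters at every step; when this fails, $\mathcal{C}(A)$ is given a separate conventional value that is not considered. The final clusters determined by an outcome are $\mathcal{C}_k=\{i\in[n]: c_i^{(J)}=k\}$, $k\in[K]$. $\mathcal{V}_{\mathrm{all}}=\{(k,k'):k<k'\in[K]\}$. $\bar\mu_{\mathcal{C}_k}=\frac{1}{|\mathcal{C}_k|}\sum_{i\in\mathcal{C}_k}\mu_i$.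 $\mathbf{1}_{\mathcal{C}_k}\in\mathbb{R}^n$ is the indicator vector of $\mathcal{C}_k$, $\mathbf{v}_{k,k'}=\frac{1}{|\mathcal{C}_k|}\mathbf{1}_{\mathcal{C}_k}-\frac{1}{|\mathcal{C}_{k'}|}\mathbf{1}_{\mathcal{C}_{k'}}$, $\mathcal{E}=\mathrm{span}\{\mathbf{v}_{k,k'}:(k,k')\in\mathcal{V}\}\subseteq\mathbb{R}^n$, $P_{\mathcal{E}}\in\mathbb{R}^{n\times n}$ is the orthogonal projection onto $\mathcal{E}$, and $P_{\mathcal{E}}^\perp=I_n-P_{\mathcal{E}}$. $\chi_d$ denotes the law of $\sqrt{Y}$ with $Y\sim\chi^2_d$. The CDF of a distribution of a random variable $W$ truncated to a set $\mathcal{S}$ is $t\mapsto\mathbb{P}(W\le t,\,W\in\mathcal{S})/\mathbb{P}(W\in\mathcal{S})$. *)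

theory Defs
  imports "HOL-Probability.Probability"
begin

text \<open>
  A matrix with rows indexed by \<open>'n\<close> and columns by \<open>'q\<close> has type \<^typ>\<open>real^'q^'n\<close>; its \<open>i\<close>-th row
  is \<open>A $ i\<close>, and the library norm on this type (the \<open>L2\<close> norm of the row norms) is the Frobenius
  norm. Cluster labels are the natural numbers in \<open>{1..K}\<close>.
\<close>

definition row_mean :: "real^'q^'n \<Rightarrow> 'n set \<Rightarrow> real^'q" where
  "row_mean A C = (1 / real (card C)) *\<^sub>R (\<Sum>i\<in>C. A $ i)"

definition nearest_centers :: "nat \<Rightarrow> (nat \<Rightarrow> real^'q) \<Rightarrow> real^'q \<Rightarrow> nat set" where
  "nearest_centers K m x = {k \<in> {1..K}. \<forall>l\<in>{1..K}. norm (x - m k) \<le> norm (x - m l)}"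

text \<open>
  A tie-breaking rule selects one label from the set of labels of the nearest centers; it may depend
  on the step and on the index of the observation, but not on the data in any other way.
\<close>

definition tie_rule :: "nat \<Rightarrow> (nat \<Rightarrow> 'n \<Rightarrow> nat set \<Rightarrow> nat) \<Rightarrow> bool" where
  "tie_rule K tb \<longleftrightarrow> (\<forall>j i S. S \<subseteq> {1..K} \<longrightarrow> S \<noteq> {} \<longrightarrow> tb j i S \<in> S)"

fun kmeans_assign :: "nat \<Rightarrow> (nat \<Rightarrow> 'n::finite) \<Rightarrow> (nat \<Rightarrow> 'n \<Rightarrow> nat set \<Rightarrow> nat) \<Rightarrow> real^'q^'n \<Rightarrow>
    nat \<Rightarrow> 'n \<Rightarrow> nat" where
  "kmeans_assign K init tb A 0 =
     (\<lambda>i. tb 0 i (nearest_centers K (\<lambda>l. A $ init l) (A $ i)))"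
| "kmeans_assign K init tb A (Suc j) =
     (\<lambda>i. tb (Suc j) i
        (nearest_centers K (\<lambda>l. row_mean A {s. kmeans_assign K init tb A j s = l}) (A $ i)))"

text \<open>
  The outcome lists the assignments of steps \<open>0, \<dots>, J\<close>. The value \<^const>\<open>None\<close> stands for a run
  in which some cluster is empty at some step.
\<close>

definition kmeans :: "nat \<Rightarrow> nat \<Rightarrow> (nat \<Rightarrow> 'n::finite) \<Rightarrow> (nat \<Rightarrow> 'n \<Rightarrow> nat set \<Rightarrow> nat) \<Rightarrow>
    real^'q^'n \<Rightarrow> ('n \<Rightarrow> nat) list option" where
  "kmeans K J init tb A =
     (if \<forall>j\<le>J. \<forall>k\<in>{1..K}. \<exists>i. kmeans_assign K init tb A j i = k
      then Some (map (kmeans_assign K init tb A) [0..<Suc J]) else None)"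

definition final_cluster :: "nat \<Rightarrow> ('n \<Rightarrow> nat) list \<Rightarrow> nat \<Rightarrow> 'n set" where
  "final_cluster J c k = {i. (c ! J) i = k}"

definition all_pairs :: "nat \<Rightarrow> (nat \<times> nat) set" where
  "all_pairs K = {(k, k'). k \<in> {1..K} \<and> k' \<in> {1..K} \<and> k < k'}"

definition contrast_vec :: "'n::finite set \<Rightarrow> 'n set \<Rightarrow> real^'n" where
  "contrast_vec C C' =
     (1 / real (card C)) *\<^sub>R (\<chi> i. indicator C i) - (1 / real (card C')) *\<^sub>R (\<chi> i. indicator C' i)"

definition contrast_space :: "(nat \<times> nat) set \<Rightarrow> (nat \<Rightarrow> 'n::finite set) \<Rightarrow> (real^'n) set" where
  "contrast_space V C = span {contrast_vec (C k) (C k') | k k'. (k, k') \<in> V}"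

definition proj_mat :: "(real^'n) set \<Rightarrow> real^'n^'n" where
  "proj_mat E = (THE P. \<forall>x. P *v x \<in> E \<and> (\<forall>y\<in>E. (x - P *v x) \<bullet> y = 0))"

lemma proj_mat_exists_unique:
  fixes E :: "(real^'n) set"
  assumes "subspace E"
  shows "\<exists>!P. \<forall>x. P *v x \<in> E \<and> (\<forall>y\<in>E. (x - P *v x) \<bullet> y = 0)"
proof -
  have uniq: "a = b" if "a \<in> E" "b \<in> E" "\<forall>y\<in>E. (x - a) \<bullet> y = 0" "\<forall>y\<in>E. (x - b) \<bullet> y = 0" for a b x
  proof -
    have "a - b \<in> E"
      using assms that(1,2) by (rule subspace_diff)
    then have "(x - b) \<bullet> (a - b) - (x - a) \<bullet> (a - b) = 0"
      using that(3,4) by simp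
    then have "(a - b) \<bullet> (a - b) = 0"
      by (simp add: inner_diff_left)
    then show ?thesis by simp
  qed
  have ex: "\<exists>a\<in>E. \<forall>y\<in>E. (x - a) \<bullet> y = 0" for x
  proof -
    obtain y z where "y \<in> span E" "\<And>w. w \<in> span E \<Longrightarrow> orthogonal z w" "x = y + z"
      using orthogonal_subspace_decomp_exists[of E x] by blast
    moreover have "span E = E"
      using assms by (simp add: span_eq_iff)
    ultimately show ?thesis
      by (intro bexI[of _ y]) (auto simp: orthogonal_def)
  qed
  then obtain p where p: "\<And>x. p x \<in> E" "\<And>x y. y \<in> E \<Longrightarrow> (x - p x) \<bullet> y = 0"
    by metis
  have "linear p"
  proof (rule linearI)
    fix a b show "p (a + b) = p a + p b"
      by (rule uniq[of _ _ "a + b"])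
        (use p assms in \<open>auto simp: subspace_add add_diff_add inner_add_left\<close>)
  next
    fix r a show "p (r *\<^sub>R a) = r *\<^sub>R p a"
      by (rule uniq[of _ _ "r *\<^sub>R a"])
        (use p assms in \<open>auto simp: subspace_scale simp flip: scaleR_right_diff_distrib\<close>)
  qed
  then have m: "matrix p *v x = p x" for x
    by (simp add: matrix_works linear_def scalar_mult_eq_scaleR[abs_def])
  show ?thesis
  proof (rule ex1I[of _ "matrix p"])
    show "\<forall>x. matrix p *v x \<in> E \<and> (\<forall>y\<in>E. (x - matrix p *v x) \<bullet> y = 0)"
      using p m by simp
  next
    fix P assume P: "\<forall>x. P *v x \<in> E \<and> (\<forall>y\<in>E. (x - P *v x) \<bullet> y = 0)"
    have "P *v x = matrix p *v x" for x
      by (rule uniq[of _ _ x]) (use p m P in auto)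
    then show "P = matrix p"
      by (simp add: matrix_eq)
  qed
qed

definition proj_perp :: "(real^'n) set \<Rightarrow> real^'n^'n" where
  "proj_perp E = mat 1 - proj_mat E"

definition test_stat :: "real \<Rightarrow> (real^'n) set \<Rightarrow> real^'q^'n \<Rightarrow> real" where
  "test_stat \<sigma> E A = norm (proj_mat E ** A) / \<sigma>"

definition cond_stat :: "(real^'n) set \<Rightarrow> real^'q^'n \<Rightarrow> (real^'q^'n) \<times> (real^'q^'n)" where
  "cond_stat E A = ((1 / norm (proj_mat E ** A)) *\<^sub>R (proj_mat E ** A), proj_perp E ** A)"

definition perturbed :: "real \<Rightarrow> (real^'n) set \<Rightarrow> real^'q^'n \<Rightarrow> real \<Rightarrow> real^'q^'n" where
  "perturbed \<sigma> E A \<psi> =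
     \<psi> *\<^sub>R ((\<sigma> / norm (proj_mat E ** A)) *\<^sub>R (proj_mat E ** A)) + proj_perp E ** A"

definition truncation_set :: "(real^'q^'n \<Rightarrow> 'c) \<Rightarrow> real \<Rightarrow> (real^'n) set \<Rightarrow> real^'q^'n \<Rightarrow> real set" where
  "truncation_set f \<sigma> E A = {\<psi>. 0 \<le> \<psi> \<and> f A = f (perturbed \<sigma> E A \<psi>)}"

text \<open>The density of the normal distribution with mean \<open>m\<close> and covariance matrix \<open>\<sigma>\<^sup>2 I\<close>, for \<open>\<sigma> > 0\<close>.\<close>

definition isotropic_normal_density :: "real^'q \<Rightarrow> real \<Rightarrow> real^'q \<Rightarrow> real" where
  "isotropic_normal_density m \<sigma> x =
     exp (- (norm (x - m))\<^sup>2 / (2 * \<sigma>\<^sup>2)) / sqrt (2 * pi * \<sigma>\<^sup>2) ^ CARD('q)"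

definition chi_square :: "nat \<Rightarrow> real measure" where
  "chi_square d =
     distr (\<Pi>\<^sub>M i\<in>{..<d}. density lborel std_normal_density) borel (\<lambda>z. \<Sum>i<d. (z i)\<^sup>2)"

definition chi :: "nat \<Rightarrow> real measure" where
  "chi d = distr (chi_square d) borel sqrt"

text \<open>
  \<open>\<kappa>\<close> is a regular conditional distribution under \<open>N\<close> of the real random variable \<open>T\<close> given the
  sub-sigma-algebra \<open>F\<close>. Conditional probabilities are determined only up to null sets that depend on
  the event, so a conditional CDF has to be read as \<^term>\<open>\<lambda>\<omega>. cdf (\<kappa> \<omega>)\<close> for such a kernel \<open>\<kappa>\<close>.
\<close>

definition regular_cond_distr ::
    "'w measure \<Rightarrow> 'w measure \<Rightarrow> ('w \<Rightarrow> real) \<Rightarrow> ('w \<Rightarrow> real measure) \<Rightarrow> bool" where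
  "regular_cond_distr N F T \<kappa> \<longleftrightarrow>
     \<kappa> \<in> F \<rightarrow>\<^sub>M prob_algebra borel \<and>
     (\<forall>B\<in>sets borel. AE \<omega> in N.
        measure (\<kappa> \<omega>) B = real_cond_exp N F (\<lambda>\<omega>'. indicator B (T \<omega>')) \<omega>)"

end

theory Submission
  imports Defs
begin

text \<open>
  The matrices whose columns lie in \<open>E\<close> form a subspace of dimension \<open>d = q dim E\<close>, and
  \<open>A \<mapsto> P\<^sub>E A\<close> is the orthogonal projection onto it; it annihilates \<open>\<mu>\<close> under the null
  hypothesis. Stretching this subspace by a factor \<open>r\<close> preserves \<open>Z\<close>, multiplies the norm of
  \<open>P\<^sub>E X\<close> by \<open>r\<close> and Lebesgue measure by \<open>r ^ d\<close>. Hence for an isotropic Gaussian \<open>X\<close> the statistic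
  \<open>T\<close> is \<open>\<chi>\<^sub>d\<close>-distributed and independent of \<open>Z\<close>. As \<open>X\<close> is a function of \<open>(Z, T)\<close>, the event
  that the outcome is \<open>c\<close> means that \<open>T\<close> lies in a slice determined by \<open>Z\<close>, and by Fubini the
  conditional law of \<open>T\<close> is the \<open>\<chi>\<^sub>d\<close> law truncated to that slice. It has no atoms, so the
  p-value is uniform by the probability integral transform.
\<close>

subsection \<open>Lebesgue measure and orthogonal transformations\<close>

text \<open>Polar coordinates would call for a surface measure; here only the scaling of Lebesgue
  measure under \<open>stretch\<close> enters. Its factor \<open>r ^ d\<close> is computed after a
  rotation of the orthonormal family into the standard basis, which is why rotation invariance of
  Lebesgue measure comes at the start. The exponent \<open>d\<close> is positive because
  \<open>V\<close> is nonempty and distinct final clusters are disjoint and nonempty; positivity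
  excludes atoms and makes the event that \<open>P\<^sub>E X\<close> vanishes a null event. A second
  obstacle is that conditional probabilities are fixed only up to null sets that depend on the
  threshold. An explicit kernel is therefore built, and any other version is compared with it at
  rational thresholds and then everywhere by right continuity.\<close>

text \<open>
  For \<open>g\<close> the indicator of the unit ball, Fubini and the two invariances turn
  \<open>(\<integral> g d\<nu>) (\<integral> h d\<lambda>)\<close> into \<open>(\<integral> g d\<lambda>) (\<integral> h d\<nu>)\<close>.
\<close>

lemma translation_invariant_eq_lborel:
  fixes \<nu> :: "'a::euclidean_space measure"
  assumes sets: "sets \<nu> = sets borel" and sf: "sigma_finite_measure \<nu>"
    and inv: "\<And>a. distr \<nu> borel (\<lambda>x. a + x) = \<nu>"
    and unit: "emeasure \<nu> (ball 0 1) = emeasure lborel (ball (0::'a) 1)"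
  shows "\<nu> = lborel"
proof -
  interpret \<nu>: sigma_finite_measure \<nu> by fact
  interpret pair_sigma_finite \<nu> "lborel :: 'a measure" ..
  note sets[measurable_cong]
  have [simp]: "space \<nu> = UNIV" using sets_eq_imp_space_eq[OF sets] by simp
  define g where "g = (indicator (ball (0::'a) 1) :: 'a \<Rightarrow> ennreal)"
  have [measurable]: "g \<in> borel_measurable borel" unfolding g_def by (intro borel_measurable_indicator borel_open open_ball)
  have inv1: "(\<integral>\<^sup>+x. f (a + x) \<partial>\<nu>) = (\<integral>\<^sup>+x. f x \<partial>\<nu>)" if "f \<in> borel_measurable borel" for f a
    by (subst (2) inv[of a, symmetric], subst nn_integral_distr) (use that in auto)
  have inv2: "(\<integral>\<^sup>+x. f (a + x) \<partial>lborel) = (\<integral>\<^sup>+x. f x \<partial>lborel)" if "f \<in> borel_measurable borel" for f and a :: 'a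
    by (subst (2) lborel_distr_plus[of a, symmetric], subst nn_integral_distr) (use that in auto)
  have inv3: "(\<integral>\<^sup>+x. f (- x) \<partial>lborel) = (\<integral>\<^sup>+x. f x \<partial>lborel)" if [measurable]: "f \<in> borel_measurable borel" for f :: "'a \<Rightarrow> ennreal"
    by (subst (2) lborel_affine[of "-1" 0])
       (auto simp: nn_integral_density nn_integral_distr density_1)
  have "emeasure \<nu> A = emeasure lborel A" if [measurable]: "A \<in> sets borel" for A
  proof -
    define h where "h = (indicator A :: 'a \<Rightarrow> ennreal)"
    have [measurable]: "h \<in> borel_measurable borel" by (simp add: h_def)
    have "(\<integral>\<^sup>+x. g x \<partial>\<nu>) * (\<integral>\<^sup>+y. h y \<partial>lborel) = (\<integral>\<^sup>+x. g x * (\<integral>\<^sup>+y. h y \<partial>lborel) \<partial>\<nu>)"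
      by (subst nn_integral_multc) auto
    also have "\<dots> = (\<integral>\<^sup>+x. (\<integral>\<^sup>+y. g x * h (x + y) \<partial>lborel) \<partial>\<nu>)"
      by (intro nn_integral_cong) (simp add: nn_integral_cmult inv2[of h])
    also have "\<dots> = (\<integral>\<^sup>+y. (\<integral>\<^sup>+x. g x * h (x + y) \<partial>\<nu>) \<partial>lborel)"
      by (rule Fubini'[symmetric]) simp
    also have "\<dots> = (\<integral>\<^sup>+y. (\<integral>\<^sup>+x. g (x - y) * h x \<partial>\<nu>) \<partial>lborel)"
    proof (rule nn_integral_cong)
      fix y :: 'a
      show "(\<integral>\<^sup>+x. g x * h (x + y) \<partial>\<nu>) = (\<integral>\<^sup>+x. g (x - y) * h x \<partial>\<nu>)"
        by (subst inv1[of "\<lambda>x. g (x - y) * h x" y, symmetric]) (auto simp: add.commute)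
    qed
    also have "\<dots> = (\<integral>\<^sup>+x. (\<integral>\<^sup>+y. g (x - y) * h x \<partial>lborel) \<partial>\<nu>)"
      by (rule Fubini') simp
    also have "\<dots> = (\<integral>\<^sup>+x. (\<integral>\<^sup>+y. g y \<partial>lborel) * h x \<partial>\<nu>)"
    proof (rule nn_integral_cong)
      fix x :: 'a
      \<comment> \<open>The reflection \<open>inv3\<close> turns \<open>x - y\<close> into
        \<open>x + y\<close>; translation invariance then removes \<open>x\<close>.\<close>
      have "(\<integral>\<^sup>+y. g (x - y) \<partial>lborel) = (\<integral>\<^sup>+y. g (x + y) \<partial>lborel)"
        by (subst inv3[symmetric]) auto
      then show "(\<integral>\<^sup>+y. g (x - y) * h x \<partial>lborel) = (\<integral>\<^sup>+y. g y \<partial>lborel) * h x"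
        by (simp add: nn_integral_multc inv2)
    qed
    also have "\<dots> = (\<integral>\<^sup>+y. g y \<partial>lborel) * (\<integral>\<^sup>+x. h x \<partial>\<nu>)"
      by (rule nn_integral_cmult) simp
    finally have eq: "emeasure lborel (ball (0::'a) 1) * emeasure lborel A = emeasure lborel (ball (0::'a) 1) * emeasure \<nu> A"
      using that unit by (simp add: g_def h_def sets)
    have "emeasure lborel (ball (0::'a) 1) \<noteq> 0"
    proof -
      have "\<not> negligible (ball (0::'a) 1)"
        by (simp add: negligible_iff_measure0 negligible_iff_emeasure0 open_not_negligible)
      then show ?thesis
        by (simp add: negligible_iff_emeasure0)
    qed
    then show ?thesis
      using eq emeasure_lborel_ball_finite[of "0::'a" 1]
      by (auto simp: ennreal_mult_cancel_left less_top)
  qed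
  then show ?thesis
    by (intro measure_eqI) (auto simp: sets)
qed

text \<open>A linear isometry preserves centred balls, and following it by a translation by
  \<open>a\<close> equals preceding it by a translation by \<open>g a\<close>, with \<open>g\<close>
  the inverse. So the image of Lebesgue measure is translation invariant with the right mass on the
  unit ball.\<close>

lemma lborel_distr_orthogonal:
  fixes f :: "'a::euclidean_space \<Rightarrow> 'a"
  assumes f: "orthogonal_transformation f"
  shows "distr lborel borel f = lborel"
proof (rule translation_invariant_eq_lborel)
  have [measurable]: "f \<in> borel_measurable borel"
    using f by (intro borel_measurable_continuous_onI linear_continuous_on linear_linear[THEN iffD2] orthogonal_transformation_linear)
  have "bij f" and lin: "linear f" using f orthogonal_transformation_bij orthogonal_transformation_linear by auto
  obtain g where g: "orthogonal_transformation g" and fg: "\<And>x. f (g x) = x" and gf: "\<And>x. g (f x) = x"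
    using orthogonal_transformation_inv[OF f] \<open>bij f\<close>
    by (metis bij_inv_eq_iff)
  have [measurable]: "g \<in> borel_measurable borel"
    using g by (intro borel_measurable_continuous_onI linear_continuous_on linear_linear[THEN iffD2] orthogonal_transformation_linear)
  show "sets (distr lborel borel f) = sets borel" by simp
  have ball: "f -` ball 0 r = ball 0 r" for r
    using orthogonal_transformation_norm[OF f] by (auto simp: dist_norm)
  show "emeasure (distr lborel borel f) (ball 0 1) = emeasure lborel (ball (0::'a) 1)"
    by (simp add: emeasure_distr ball)
  show "sigma_finite_measure (distr lborel borel f)"
  proof
    show "\<exists>A. countable A \<and> A \<subseteq> sets (distr lborel borel f) \<and> \<Union> A = space (distr lborel borel f) \<and> (\<forall>a\<in>A. emeasure (distr lborel borel f) a \<noteq> \<infinity>)"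
    proof (intro exI[of _ "range (\<lambda>n. ball 0 (real n))"] conjI ballI)
      show "\<Union> (range (\<lambda>n. ball (0::'a) (real n))) = space (distr lborel borel f)"
        using reals_Archimedean2 by (auto simp: dist_norm)
    next
      fix a assume "a \<in> range (\<lambda>n. ball (0::'a) (real n))"
      then show "emeasure (distr lborel borel f) a \<noteq> \<infinity>"
        using emeasure_lborel_ball_finite[of "0::'a"] by (auto simp: emeasure_distr ball less_top)
    qed auto
  qed
  fix a
  have "distr (distr lborel borel f) borel ((+) a) = distr (distr lborel borel ((+) (g a))) borel f"
    by (subst (1 2) distr_distr) (auto simp: comp_def linear_add[OF lin] fg)
  then show "distr (distr lborel borel f) borel (\<lambda>x. a + x) = distr lborel borel f"
    by (simp add: lborel_distr_plus)
qed

text \<open>Provides adapted coordinates: the family is completed to an orthonormal basis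
  \<open>O2\<close>, and a bijection of \<open>O2\<close> onto the standard basis extends linearly
  to an isometry. Projections and stretches along the family then act coordinatewise.\<close>

lemma orthonormal_rotate:
  fixes b :: "nat \<Rightarrow> 'a::euclidean_space"
  assumes on: "\<And>i j. i < d \<Longrightarrow> j < d \<Longrightarrow> b i \<bullet> b j = (if i = j then 1 else 0)"
  obtains f e where "orthogonal_transformation f" "inj_on e {..<d}" "e ` {..<d} \<subseteq> (Basis :: 'a set)"
    "\<And>i. i < d \<Longrightarrow> f (b i) = e i"
proof -
  have inj: "inj_on b {..<d}"
    by (rule inj_onI) (metis lessThan_iff on zero_neq_one)
  define O1 where "O1 = b ` {..<d}"
  have po: "pairwise orthogonal O1"
    unfolding O1_def by (auto simp: pairwise_def orthogonal_def on)
  obtain U where U: "U \<inter> (insert 0 O1) = {}" "pairwise orthogonal (O1 \<union> U)" "span (O1 \<union> U) = span (O1 \<union> UNIV)"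
    using orthogonal_extension_strong[OF po, of UNIV] by metis
  \<comment> \<open>The extension \<open>U\<close> is orthogonal but not normalised; it avoids 0, so
    its vectors can be divided by their norms.\<close>
  define O2 where "O2 = O1 \<union> (\<lambda>x. x /\<^sub>R norm x) ` U"
  have O1n: "norm x = 1" if "x \<in> O1" for x
    using that on by (auto simp: O1_def norm_eq_1)
  have O2n: "norm x = 1" if "x \<in> O2" for x
    using that U(1) by (auto simp: O2_def O1n field_simps)
  have O2_eq: "O2 = (\<lambda>x. x /\<^sub>R norm x) ` (O1 \<union> U)"
    by (simp add: O2_def image_Un O1n)
  have po2: "pairwise orthogonal O2"
  proof (rule pairwiseI)
    fix x y assume "x \<in> O2" "y \<in> O2" and ne: "x \<noteq> y"
    then obtain a c where "a \<in> O1 \<union> U" "c \<in> O1 \<union> U" "x = a /\<^sub>R norm a" "y = c /\<^sub>R norm c"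
      unfolding O2_eq by blast
    with ne U(2) show "orthogonal x y"
      unfolding pairwise_def orthogonal_def by (metis inner_scaleR_left inner_scaleR_right mult_zero_right)
  qed
  have ind: "independent O2"
    using po2 O2n by (intro pairwise_orthogonal_independent) (auto dest: O2n)
  then have fin: "finite O2" by (rule independent_imp_finite)
  have "span O2 = UNIV"
  proof -
    have "U \<subseteq> span O2"
    proof
      fix x assume x: "x \<in> U"
      then have "x /\<^sub>R norm x \<in> span O2" by (auto simp: O2_def intro: span_base)
      then have "norm x *\<^sub>R (x /\<^sub>R norm x) \<in> span O2" by (rule span_mul)
      moreover have "x \<noteq> 0" using x U(1) by auto
      ultimately show "x \<in> span O2" by simp
    qed
    moreover have "O1 \<subseteq> span O2" by (auto simp: O2_def intro: span_base)
    ultimately have "span (O1 \<union> U) \<subseteq> span O2"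
      by (intro span_minimal) auto
    then show ?thesis using U(3) by auto
  qed
  then have card: "card O2 = DIM('a)"
    using ind dim_eq_card[of O2 UNIV] by (simp add: dim_UNIV)
  have "card O1 \<le> card (Basis :: 'a set)"
    using card card_mono[OF fin, of O1] by (auto simp: O2_def)
  then obtain B where B: "B \<subseteq> (Basis :: 'a set)" "card B = card O1"
    by (metis obtain_subset_with_card_n)
  have finO1: "finite O1" by (simp add: O1_def)
  obtain p1 where p1: "bij_betw p1 O1 B"
    using finite_same_card_bij[of O1 B] B finO1 finite_subset[OF B(1) finite_Basis] by auto
  have "card (O2 - O1) = card (Basis - B)"
    using card B finO1 finite_subset[OF B(1) finite_Basis]
    by (auto simp: O2_def card_Diff_subset)
  then obtain p2 where p2: "bij_betw p2 (O2 - O1) (Basis - B)"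
    using finite_same_card_bij[of "O2 - O1" "Basis - B"] fin by auto
  define p where "p x = (if x \<in> O1 then p1 x else p2 x)" for x
  have "bij_betw p O1 B" using p1 by (subst bij_betw_cong[of _ _ p1]) (auto simp: p_def)
  moreover have "bij_betw p (O2 - O1) (Basis - B)" using p2 by (subst bij_betw_cong[of _ _ p2]) (auto simp: p_def)
  ultimately have "bij_betw p (O1 \<union> (O2 - O1)) (B \<union> (Basis - B))"
    by (rule bij_betw_combine) auto
  moreover have "O1 \<union> (O2 - O1) = O2" "B \<union> (Basis - B) = Basis" using B by (auto simp: O2_def)
  ultimately have p: "bij_betw p O2 Basis" by simp
  define f where "f x = (\<Sum>u\<in>O2. (x \<bullet> u) *\<^sub>R p u)" for x
  have pin: "p u \<in> Basis" if "u \<in> O2" for u using p that by (auto simp: bij_betw_def)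
  have pinj: "p u = p v \<longleftrightarrow> u = v" if "u \<in> O2" "v \<in> O2" for u v
    using p that by (auto simp: bij_betw_def inj_on_def)
  have O2in: "u \<bullet> v = (if u = v then 1 else 0)" if "u \<in> O2" "v \<in> O2" for u v
    using that po2 O2n by (auto simp: pairwise_def orthogonal_def norm_eq_1)
  have fO: "f u = p u" if "u \<in> O2" for u
  proof -
    have "f u = (\<Sum>v\<in>O2. if v = u then p v else 0)"
      unfolding f_def by (rule sum.cong) (auto simp: O2in that)
    then show ?thesis using that fin by simp
  qed
  have lin: "linear f"
    by (rule linearI) (auto simp: f_def inner_add_left scaleR_left_distrib sum.distrib scaleR_sum_right)
  have *: "f x \<bullet> f u = x \<bullet> u" if u: "u \<in> O2" for x u
  proof -
    have "f x \<bullet> f u = (\<Sum>v\<in>O2. (x \<bullet> v) * (p v \<bullet> p u))"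
      by (simp add: fO[OF u]) (simp add: f_def inner_sum_left)
    also have "\<dots> = (\<Sum>v\<in>O2. if v = u then x \<bullet> v else 0)"
      by (rule sum.cong) (auto simp: inner_Basis pin u pinj)
    finally show ?thesis using u fin by simp
  qed
  have "f x \<bullet> f y = x \<bullet> y" for x y
  proof -
    have "y \<in> span O2" using \<open>span O2 = UNIV\<close> by simp
    then show ?thesis
      by (induction rule: span_induct_alt)
        (auto simp: linear_0[OF lin] linear_add[OF lin] linear_cmul[OF lin] inner_add_right *)
  qed
  then have ot: "orthogonal_transformation f" using lin by (simp add: orthogonal_transformation_def)
  show ?thesis
  proof
    show "orthogonal_transformation f" by fact
    show "f (b i) = (\<lambda>i. p (b i)) i" if "i < d" for i
      using that by (simp add: fO O2_def O1_def)
    show "inj_on (\<lambda>i. p (b i)) {..<d}"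
      using inj by (auto simp: inj_on_def pinj O2_def O1_def)
    show "(\<lambda>i. p (b i)) ` {..<d} \<subseteq> Basis"
      by (auto intro!: pin simp: O2_def O1_def)
  qed
qed

subsection \<open>Isotropic Gaussian measures\<close>

text \<open>On boxes the integral of a product of one-variable functions factors; sigma-finiteness
  of the factors on the right, hypothesis \<open>D\<close>, makes boxes determine the product
  measure.\<close>

lemma PiM_density:
  assumes I: "finite I" and M: "\<And>i. sigma_finite_measure (M i)"
    and D: "\<And>i. sigma_finite_measure (density (M i) (f i))"
    and f[measurable]: "\<And>i. f i \<in> borel_measurable (M i)"
  shows "density (PiM I M) (\<lambda>x. \<Prod>i\<in>I. f i (x i)) = PiM I (\<lambda>i. density (M i) (f i))"
proof (rule product_sigma_finite.PiM_eqI[OF _ I])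
  show "product_sigma_finite (\<lambda>i. density (M i) (f i))"
    by (simp add: product_sigma_finite_def D)
  interpret product_sigma_finite M by (simp add: product_sigma_finite_def M)
  show "sets (density (PiM I M) (\<lambda>x. \<Prod>i\<in>I. f i (x i))) = sets (PiM I (\<lambda>i. density (M i) (f i)))"
    by (simp cong: sets_PiM_cong)
  fix A assume A: "\<And>i. i \<in> I \<Longrightarrow> A i \<in> sets (density (M i) (f i))"
  then have [measurable]: "Pi\<^sub>E I A \<in> sets (PiM I M)" using I by (intro sets_PiM_I_finite) auto
  have "emeasure (density (PiM I M) (\<lambda>x. \<Prod>i\<in>I. f i (x i))) (Pi\<^sub>E I A)
      = (\<integral>\<^sup>+x. (\<Prod>i\<in>I. f i (x i)) * indicator (Pi\<^sub>E I A) x \<partial>PiM I M)"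
    by (rule emeasure_density) auto
  also have "\<dots> = (\<integral>\<^sup>+x. (\<Prod>i\<in>I. f i (x i) * indicator (A i) (x i)) \<partial>PiM I M)"
  proof (rule nn_integral_cong)
    fix x assume "x \<in> space (PiM I M)"
    then have "indicator (Pi\<^sub>E I A) x = (\<Prod>i\<in>I. indicator (A i) (x i) :: ennreal)"
      using I by (auto simp: indicator_def space_PiM PiE_def Pi_def prod_zero_iff)
    then show "(\<Prod>i\<in>I. f i (x i)) * indicator (Pi\<^sub>E I A) x = (\<Prod>i\<in>I. f i (x i) * indicator (A i) (x i))"
      by (simp add: prod.distrib)
  qed
  also have "\<dots> = (\<Prod>i\<in>I. \<integral>\<^sup>+x. f i x * indicator (A i) x \<partial>M i)"
    using A I by (intro product_nn_integral_prod) auto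
  also have "\<dots> = (\<Prod>i\<in>I. emeasure (density (M i) (f i)) (A i))"
    using A by (intro prod.cong) (auto simp: emeasure_density)
  finally show "emeasure (density (PiM I M) (\<lambda>x. \<Prod>i\<in>I. f i (x i))) (Pi\<^sub>E I A)
      = (\<Prod>i\<in>I. emeasure (density (M i) (f i)) (A i))" .
qed

text \<open>Stated for every Euclidean space, so that the law of a row and the law of the whole
  matrix, with its Frobenius norm, are instances of one notion; on row vectors it is
  \<open>isotropic_normal_density\<close>.\<close>

definition gauss_density :: "'a::euclidean_space \<Rightarrow> real \<Rightarrow> 'a \<Rightarrow> real" where
  "gauss_density m s x = exp (- (norm (x - m))\<^sup>2 / (2 * s\<^sup>2)) / sqrt (2 * pi * s\<^sup>2) ^ DIM('a)"

definition gauss :: "'a::euclidean_space \<Rightarrow> real \<Rightarrow> 'a measure" where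
  "gauss m s = density lborel (\<lambda>x. ennreal (gauss_density m s x))"

lemma gauss_density_nonneg: "0 \<le> gauss_density m s x"
  by (simp add: gauss_density_def)

lemma borel_measurable_gauss_density[measurable]: "gauss_density m s \<in> borel_measurable borel"
  unfolding gauss_density_def[abs_def] by measurable

lemma sets_gauss[simp, measurable_cong]: "sets (gauss m s) = sets borel"
  by (simp add: gauss_def)

lemma space_gauss[simp]: "space (gauss m s) = UNIV"
  by (simp add: gauss_def)

text \<open>The squared norm is the sum of the squared coordinates, so the exponential splits into
  one-dimensional normal densities. Such a product is also what \<open>chi_square\<close> is built
  from.\<close>

lemma standard_gauss_eq_PiM:
  "gauss (0::'a::euclidean_space) 1 =
     distr (\<Pi>\<^sub>M b\<in>Basis. density lborel std_normal_density) borel (\<lambda>w. \<Sum>b\<in>Basis. w b *\<^sub>R b)"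
proof -
  have "gauss (0::'a) 1 = density (distr (\<Pi>\<^sub>M b\<in>Basis. lborel) borel (\<lambda>f. \<Sum>b\<in>Basis. f b *\<^sub>R b)) (gauss_density (0::'a) 1)"
    unfolding gauss_def by (subst lborel_eq) simp
  also have "\<dots> = distr (density (\<Pi>\<^sub>M b\<in>Basis. lborel) (\<lambda>w. gauss_density (0::'a) 1 (\<Sum>b\<in>Basis. w b *\<^sub>R b))) borel
      (\<lambda>w. \<Sum>b\<in>Basis. w b *\<^sub>R b)"
    by (subst density_distr) auto
  also have "density (\<Pi>\<^sub>M b\<in>Basis. lborel) (\<lambda>w. gauss_density (0::'a) 1 (\<Sum>b\<in>Basis. w b *\<^sub>R b))
      = density (\<Pi>\<^sub>M b\<in>Basis. lborel) (\<lambda>w. \<Prod>b\<in>(Basis :: 'a set). ennreal (std_normal_density (w b)))"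
  proof (rule arg_cong[where f="density _"], rule ext)
    fix w :: "'a \<Rightarrow> real"
    have "(norm (\<Sum>b\<in>Basis. w b *\<^sub>R b))\<^sup>2 = (\<Sum>b\<in>(Basis::'a set). (w b)\<^sup>2)"
      by (subst norm_sum_Pythagorean) (auto simp: pairwise_def orthogonal_def inner_Basis)
    then have "gauss_density (0::'a) 1 (\<Sum>b\<in>Basis. w b *\<^sub>R b) = (\<Prod>b\<in>(Basis::'a set). std_normal_density (w b))"
      by (simp add: gauss_density_def std_normal_density_def prod_dividef sum_negf[symmetric] sum_divide_distrib exp_sum)
    then show "ennreal (gauss_density (0::'a) 1 (\<Sum>b\<in>Basis. w b *\<^sub>R b)) = (\<Prod>b\<in>(Basis::'a set). ennreal (std_normal_density (w b)))"
      by (simp add: prod_ennreal)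
  qed
  also have "\<dots> = (\<Pi>\<^sub>M b\<in>(Basis :: 'a set). density lborel std_normal_density)"
    by (rule PiM_density)
       (auto intro!: prob_space_imp_sigma_finite prob_space_normal_density lborel.sigma_finite_measure_axioms)
  finally show ?thesis .
qed

lemma prob_space_standard_gauss: "prob_space (gauss (0::'a::euclidean_space) 1)"
  unfolding standard_gauss_eq_PiM
  by (intro prob_space.prob_space_distr prob_space_PiM prob_space_normal_density) auto

text \<open>The Jacobian of the scaling cancels against the normalising constant, and the isometry
  \<open>f\<close> drops out of the density. Leaving \<open>f\<close> free allows a rotation to be
  inserted where the chi law is derived.\<close>

lemma gauss_eq_distr_standard:
  fixes f :: "'a::euclidean_space \<Rightarrow> 'a"
  assumes f: "orthogonal_transformation f" and s: "0 < s"
  shows "gauss m s = distr (gauss 0 1) borel (\<lambda>y. m + s *\<^sub>R f y)"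
proof -
  have [measurable]: "f \<in> borel_measurable borel"
    using f by (intro borel_measurable_continuous_onI linear_continuous_on linear_linear[THEN iffD2] orthogonal_transformation_linear)
  have "lborel = density (distr lborel borel (\<lambda>x::'a. m + s *\<^sub>R x)) (\<lambda>_. ennreal (\<bar>s\<bar>^DIM('a)))"
    using s by (intro lborel_affine) auto
  also have "distr lborel borel (\<lambda>x::'a. m + s *\<^sub>R x) = distr (distr lborel borel f) borel (\<lambda>x::'a. m + s *\<^sub>R x)"
    by (simp add: lborel_distr_orthogonal[OF f])
  also have "\<dots> = distr lborel borel (\<lambda>x. m + s *\<^sub>R f x)"
    by (subst distr_distr) (auto simp: comp_def)
  finally have "gauss m s = density (density (distr lborel borel (\<lambda>x. m + s *\<^sub>R f x)) (\<lambda>_. ennreal (\<bar>s\<bar>^DIM('a)))) (gauss_density m s)"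
    unfolding gauss_def by simp
  also have "\<dots> = distr (density lborel (\<lambda>x. ennreal (\<bar>s\<bar>^DIM('a)) * ennreal (gauss_density m s (m + s *\<^sub>R f x)))) borel (\<lambda>x. m + s *\<^sub>R f x)"
    by (subst density_density_eq, simp, simp, subst density_distr) auto
  also have "(\<lambda>x. ennreal (\<bar>s\<bar>^DIM('a)) * ennreal (gauss_density m s (m + s *\<^sub>R f x))) = (\<lambda>x. ennreal (gauss_density 0 1 x))"
  proof
    fix x
    have "\<bar>s\<bar>^DIM('a) * gauss_density m s (m + s *\<^sub>R f x) = gauss_density 0 1 x"
      using s by (simp add: gauss_density_def orthogonal_transformation_norm[OF f] power_mult_distrib real_sqrt_mult)
    then show "ennreal (\<bar>s\<bar>^DIM('a)) * ennreal (gauss_density m s (m + s *\<^sub>R f x)) = ennreal (gauss_density 0 1 x)"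
      by (simp add: ennreal_mult[symmetric] gauss_density_nonneg)
  qed
  finally show ?thesis by (simp add: gauss_def)
qed

lemma prob_space_gauss: "0 < s \<Longrightarrow> prob_space (gauss (m::'a::euclidean_space) s)"
  using gauss_eq_distr_standard[OF orthogonal_transformation_id, of s m]
  by (simp add: prob_space.prob_space_distr[OF prob_space_standard_gauss])

section \<open>Gaussian matrices as tuples of independent rows\<close>

lemma borel_measurable_vec_lambda[measurable]:
  "(vec_lambda :: ('n::finite \<Rightarrow> 'a::euclidean_space) \<Rightarrow> 'a^'n) \<in> (\<Pi>\<^sub>M i\<in>UNIV. borel) \<rightarrow>\<^sub>M borel"
proof (subst borel_measurable_euclidean_space, rule ballI)
  fix b :: "'a^'n" assume "b \<in> Basis"
  then obtain i u where "b = axis i u" by (auto simp: Basis_vec_def)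
  then show "(\<lambda>w. vec_lambda w \<bullet> b) \<in> borel_measurable (\<Pi>\<^sub>M i\<in>(UNIV::'n set). (borel :: 'a measure))"
    by (simp add: inner_axis)
qed

lemma prod_Basis_vec:
  fixes h :: "'a::euclidean_space ^ 'n \<Rightarrow> 'b::comm_monoid_mult"
  shows "(\<Prod>b\<in>Basis. h b) = (\<Prod>i\<in>UNIV. \<Prod>u\<in>Basis. h (axis i u))"
proof -
  have "(\<Prod>b\<in>Basis. h b) = (\<Prod>b\<in>(\<lambda>(i, u). axis i u) ` (UNIV \<times> Basis). h b)"
    by (rule prod.cong) (auto simp: Basis_vec_def)
  also have "\<dots> = (\<Prod>(i, u)\<in>UNIV \<times> Basis. h (axis i u))"
    by (subst prod.reindex) (auto simp: inj_on_def axis_eq_axis nonzero_Basis split_beta comp_def)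
  finally show ?thesis by (simp add: prod.cartesian_product)
qed

lemma lborel_vec_eq_distr_PiM:
  "(lborel :: ('a::euclidean_space ^ 'n) measure) = distr (\<Pi>\<^sub>M i\<in>UNIV. lborel) borel vec_lambda"
proof (rule lborel_eqI)
  interpret product_sigma_finite "\<lambda>_::'n. lborel :: 'a measure"
    by (simp add: product_sigma_finite_def lborel.sigma_finite_measure_axioms)
  have [measurable]: "vec_lambda \<in> (\<Pi>\<^sub>M i\<in>UNIV. lborel) \<rightarrow>\<^sub>M (borel :: ('a^'n) measure)"
    by (subst measurable_cong_sets[OF sets_PiM_cong[OF refl sets_lborel] refl]) (rule borel_measurable_vec_lambda)
  fix l u :: "'a^'n" assume le: "\<And>b. b \<in> Basis \<Longrightarrow> l \<bullet> b \<le> u \<bullet> b"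
  have le': "l $ i \<bullet> b \<le> u $ i \<bullet> b" if "b \<in> Basis" for i b
    using le[of "axis i b"] that by (auto simp: inner_axis Basis_vec_def)
  have "vec_lambda -` box l u \<inter> space (\<Pi>\<^sub>M i\<in>UNIV. lborel) = (\<Pi>\<^sub>E i\<in>UNIV. box (l $ i) (u $ i))"
    by (auto simp: box_def Basis_vec_def inner_axis space_PiM PiE_def Pi_def)
  then have "emeasure (distr (\<Pi>\<^sub>M i\<in>UNIV. lborel) borel vec_lambda) (box l u)
      = emeasure (\<Pi>\<^sub>M i\<in>UNIV. lborel) (\<Pi>\<^sub>E i\<in>UNIV. box (l $ i) (u $ i))"
    by (subst emeasure_distr) auto
  also have "\<dots> = (\<Prod>i\<in>UNIV. emeasure lborel (box (l $ i) (u $ i)))"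
    by (rule emeasure_PiM) auto
  also have "\<dots> = (\<Prod>i\<in>UNIV. ennreal (\<Prod>b\<in>Basis. (u $ i - l $ i) \<bullet> b))"
    using le' by (simp add: emeasure_lborel_box_eq)
  also have "\<dots> = ennreal (\<Prod>b\<in>Basis. (u - l) \<bullet> b)"
    using le' by (subst prod_ennreal) (auto intro!: prod_nonneg simp: prod_Basis_vec inner_axis inner_diff_left)
  finally show "emeasure (distr (\<Pi>\<^sub>M i\<in>UNIV. lborel) borel vec_lambda) (box l u) = ennreal (\<Prod>b\<in>Basis. (u - l) \<bullet> b)" .
qed simp

text \<open>The squared norm of a vector of rows is the sum of the squared row norms, so independent
  isotropic rows with a common scale amount to one isotropic Gaussian on the whole space.\<close>

lemma gauss_vec_eq_distr_PiM:
  fixes m :: "'a::euclidean_space ^ 'n"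
  assumes "0 < s"
  shows "gauss m s = distr (\<Pi>\<^sub>M i\<in>UNIV. gauss (m $ i) s) borel vec_lambda"
proof -
  have [measurable]: "vec_lambda \<in> (\<Pi>\<^sub>M i\<in>UNIV. lborel) \<rightarrow>\<^sub>M (borel :: ('a^'n) measure)"
    by (subst measurable_cong_sets[OF sets_PiM_cong[OF refl sets_lborel] refl]) (rule borel_measurable_vec_lambda)
  have "gauss m s = distr (density (\<Pi>\<^sub>M i\<in>UNIV. lborel) (\<lambda>w. gauss_density m s (vec_lambda w))) borel vec_lambda"
    unfolding gauss_def by (subst lborel_vec_eq_distr_PiM, subst density_distr) auto
  also have "(\<lambda>w. ennreal (gauss_density m s (vec_lambda w))) = (\<lambda>w. \<Prod>i\<in>UNIV. ennreal (gauss_density (m $ i) s (w i)))"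
  proof
    fix w :: "'n \<Rightarrow> 'a"
    have "(norm (vec_lambda w - m))\<^sup>2 = (\<Sum>i\<in>UNIV. (norm (w i - m $ i))\<^sup>2)"
      by (simp add: norm_vec_def L2_set_def sum_nonneg)
    then have "gauss_density m s (vec_lambda w) = (\<Prod>i\<in>UNIV. gauss_density (m $ i) s (w i))"
      by (simp add: gauss_density_def prod_dividef exp_sum[symmetric] sum_negf[symmetric] sum_divide_distrib power_mult[symmetric] mult.commute)
    then show "ennreal (gauss_density m s (vec_lambda w)) = (\<Prod>i\<in>UNIV. ennreal (gauss_density (m $ i) s (w i)))"
      by (simp add: prod_ennreal gauss_density_nonneg)
  qed
  also have "density (\<Pi>\<^sub>M i\<in>UNIV. lborel) (\<lambda>w. \<Prod>i\<in>UNIV. ennreal (gauss_density (m $ i) s (w i)))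
      = (\<Pi>\<^sub>M i\<in>UNIV. gauss (m $ i) s)"
    unfolding gauss_def
    using prob_space_gauss[OF assms, unfolded gauss_def]
    by (intro PiM_density) (auto intro!: prob_space_imp_sigma_finite lborel.sigma_finite_measure_axioms)
  finally show ?thesis .
qed

subsection \<open>Independence of norm and direction\<close>

text \<open>Works in an abstract Euclidean space, later the space of matrices. The indices run over
  \<open>{..<d}\<close> to match the coordinates in \<open>chi_square d\<close>.\<close>

locale orthonormal_family =
  fixes b :: "nat \<Rightarrow> 'a::euclidean_space" and d :: nat
  assumes orthonormal: "\<And>i j. i < d \<Longrightarrow> j < d \<Longrightarrow> b i \<bullet> b j = (if i = j then 1 else 0)"
begin

definition proj :: "'a \<Rightarrow> 'a" where
  "proj x = (\<Sum>i<d. (x \<bullet> b i) *\<^sub>R b i)"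

lemma proj_add: "proj (x + y) = proj x + proj y"
  by (simp add: proj_def inner_add_left scaleR_left_distrib sum.distrib)

lemma proj_scaleR: "proj (r *\<^sub>R x) = r *\<^sub>R proj x"
  by (simp add: proj_def scaleR_sum_right)

lemma linear_proj: "linear proj"
  by (rule linearI) (simp_all add: proj_add proj_scaleR)

lemma proj_diff: "proj (x - y) = proj x - proj y"
  by (rule linear_diff[OF linear_proj])

lemma borel_measurable_proj[measurable]: "proj \<in> borel_measurable borel"
  unfolding proj_def[abs_def] by measurable

lemma inner_proj_left: "j < d \<Longrightarrow> proj x \<bullet> b j = x \<bullet> b j"
  by (simp add: proj_def inner_sum_left orthonormal if_distrib[of "(*) _"] cong: if_cong)

lemma proj_proj: "proj (proj x) = proj x"
  by (subst (1 3) proj_def) (simp add: inner_proj_left)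

lemma proj_eq_0: "(\<And>i. i < d \<Longrightarrow> x \<bullet> b i = 0) \<Longrightarrow> proj x = 0"
  by (simp add: proj_def)

lemma inner_proj_proj: "x \<bullet> proj y = proj x \<bullet> proj y"
  by (simp add: proj_def[of y] inner_sum_right inner_proj_left)

lemma norm_proj_sq: "(norm (proj x))\<^sup>2 = (\<Sum>i<d. (x \<bullet> b i)\<^sup>2)"
  unfolding power2_norm_eq_inner inner_proj_proj[symmetric]
  by (simp add: proj_def inner_sum_right power2_eq_square)

lemma proj_basis: "i < d \<Longrightarrow> proj (b i) = b i"
  by (simp add: proj_def orthonormal if_distrib[of "\<lambda>u. u *\<^sub>R _"] cong: if_cong)

lemma basis_nz: "i < d \<Longrightarrow> b i \<noteq> 0"
  using orthonormal[of i i] by auto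

definition stretch :: "real \<Rightarrow> 'a \<Rightarrow> 'a" where
  "stretch r x = r *\<^sub>R proj x + (x - proj x)"

lemma borel_measurable_stretch[measurable]: "stretch r \<in> borel_measurable borel"
  unfolding stretch_def[abs_def] by measurable

lemma proj_stretch: "proj (stretch r x) = r *\<^sub>R proj x"
  by (simp add: stretch_def proj_add proj_scaleR proj_proj proj_diff)

lemma perp_stretch: "stretch r x - proj (stretch r x) = x - proj x"
  by (simp only: proj_stretch) (simp add: stretch_def)

text \<open>Conjugation with the rotation \<open>f\<close> makes the map diagonal: it multiplies
  \<open>d\<close> standard coordinates by \<open>r\<close> and fixes the others, so its determinant
  is \<open>r ^ d\<close>.\<close>

lemma lborel_stretch:
  assumes r: "0 < r"
  shows "lborel = density (distr lborel borel (stretch r)) (\<lambda>_. ennreal (r ^ d))"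
proof -
  obtain f and e where f: "orthogonal_transformation f" and e: "inj_on e {..<d}" "e ` {..<d} \<subseteq> (Basis :: 'a set)"
    and fb: "\<And>i. i < d \<Longrightarrow> f (b i) = e i"
    using orthonormal_rotate[of d b] orthonormal by metis
  have lin: "linear f" using f by (rule orthogonal_transformation_linear)
  obtain g where g: "orthogonal_transformation g" and fg: "\<And>x. f (g x) = x" and gf: "\<And>x. g (f x) = x"
    using orthogonal_transformation_inv[OF f] orthogonal_transformation_bij[OF f]
    by (metis bij_inv_eq_iff)
  have [measurable]: "f \<in> borel_measurable borel" "g \<in> borel_measurable borel"
    using f g by (auto intro!: borel_measurable_continuous_onI linear_continuous_on linear_linear[THEN iffD2] orthogonal_transformation_linear)
  define c where "c j = (if j \<in> e ` {..<d} then r else 1)" for j :: 'a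
  \<comment> \<open>The summand \<open>0\<close> is the translation vector of the affine map in
    \<open>lborel_affine_euclidean\<close>, which is applied below.\<close>
  define D where "D y = 0 + (\<Sum>j\<in>Basis. (c j * (y \<bullet> j)) *\<^sub>R j)" for y :: 'a
  have [measurable]: "D \<in> borel_measurable borel"
    unfolding D_def[abs_def] by measurable
  have fx: "x \<bullet> b i = f x \<bullet> e i" if "i < d" for x i
    using f fb[OF that] by (metis orthogonal_transformation_def)
  have "f (stretch r x) = D (f x)" for x
  proof (rule euclidean_eqI)
    fix j :: 'a assume j: "j \<in> Basis"
    have fp: "f (proj x) \<bullet> j = (if j \<in> e ` {..<d} then f x \<bullet> j else 0)"
    proof -
      have "f (proj x) = (\<Sum>i<d. (f x \<bullet> e i) *\<^sub>R e i)"
        by (simp add: proj_def linear_sum[OF lin] linear_cmul[OF lin] fb fx)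
      also have "\<dots> = (\<Sum>k\<in>e ` {..<d}. (f x \<bullet> k) *\<^sub>R k)"
        by (simp add: sum.reindex[OF e(1)])
      finally have "f (proj x) \<bullet> j = (\<Sum>k\<in>e ` {..<d}. (f x \<bullet> k) * (k \<bullet> j))"
        by (simp add: inner_sum_left)
      also have "\<dots> = (\<Sum>k\<in>e ` {..<d}. if k = j then f x \<bullet> k else 0)"
        using e(2) j by (intro sum.cong refl) (auto simp: inner_Basis subset_iff)
      finally show ?thesis by simp
    qed
    have "f (stretch r x) \<bullet> j = r * (f (proj x) \<bullet> j) + (f x \<bullet> j - f (proj x) \<bullet> j)"
      by (simp add: stretch_def linear_add[OF lin] linear_cmul[OF lin] linear_diff[OF lin] inner_add_left inner_diff_left)
    also have "\<dots> = D (f x) \<bullet> j"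
      using j by (simp add: fp D_def c_def inner_sum_left inner_Basis if_distrib[of "(*) _"] cong: if_cong)
    finally show "f (stretch r x) \<bullet> j = D (f x) \<bullet> j" .
  qed
  then have str: "stretch r = (\<lambda>x. g (D (f x)))"
    by (metis gf)
  have "(\<Prod>j\<in>Basis. \<bar>c j\<bar>) = (\<Prod>j\<in>e ` {..<d}. r)"
    using e(2) r by (intro prod.mono_neutral_cong_right) (auto simp: c_def)
  also have "\<dots> = r ^ d" using e(1) by (simp add: card_image)
  finally have c: "(\<Prod>j\<in>Basis. \<bar>c j\<bar>) = r ^ d" .
  have "distr lborel borel (stretch r) = distr (distr (distr lborel borel f) borel D) borel g"
    unfolding str by (simp add: distr_distr comp_def)
  also have "\<dots> = distr (distr lborel borel D) borel g"
    by (simp add: lborel_distr_orthogonal[OF f])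
  finally have "density (distr lborel borel (stretch r)) (\<lambda>_. ennreal (r ^ d))
     = distr (density (distr lborel borel D) (\<lambda>_. ennreal (r ^ d))) borel g"
    by (simp add: density_distr)
  also have "density (distr lborel borel D) (\<lambda>_. ennreal (r ^ d)) = lborel"
    unfolding D_def[abs_def] c[symmetric]
    by (rule lborel_affine_euclidean[symmetric]) (use r in \<open>auto simp: c_def\<close>)
  finally show ?thesis by (simp add: lborel_distr_orthogonal[OF g])
qed

text \<open>A centred isotropic Gaussian does not change under the rotation that carries the family
  to standard basis vectors. As \<open>m\<close> has no component along the family, the scaled norm
  of the projection becomes the root of a sum of \<open>d\<close> squared independent standard
  normal coordinates.\<close>

lemma norm_proj_distr_gauss:
  assumes s: "0 < s" and m: "proj m = 0"
  shows "distr (gauss m s) borel (\<lambda>x. norm (proj x) / s) = chi d"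
proof -
  obtain f and e where f: "orthogonal_transformation f" and e: "inj_on e {..<d}" "e ` {..<d} \<subseteq> (Basis :: 'a set)"
    and fb: "\<And>i. i < d \<Longrightarrow> f (b i) = e i"
    using orthonormal_rotate[of d b] orthonormal by metis
  obtain g where g: "orthogonal_transformation g" and fg: "\<And>x. f (g x) = x"
    using orthogonal_transformation_inv[OF f] orthogonal_transformation_bij[OF f]
    by (metis bij_inv_eq_iff)
  have [measurable]: "g \<in> borel_measurable borel"
    using g by (auto intro!: borel_measurable_continuous_onI linear_continuous_on linear_linear[THEN iffD2] orthogonal_transformation_linear)
  define L where "L y = (\<lambda>i\<in>{..<d}. y \<bullet> e i)" for y :: 'a
  have L[measurable]: "L \<in> borel \<rightarrow>\<^sub>M (\<Pi>\<^sub>M i\<in>{..<d}. borel)"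
    unfolding L_def[abs_def] by measurable
  have Ld: "L \<in> borel \<rightarrow>\<^sub>M (\<Pi>\<^sub>M i\<in>{..<d}. density lborel std_normal_density)"
    by (subst measurable_cong_sets[OF refl sets_PiM_cong[OF refl]]) (auto intro: L)
  have L_distr: "distr (gauss (0::'a) 1) (\<Pi>\<^sub>M i\<in>{..<d}. density lborel std_normal_density) L
      = (\<Pi>\<^sub>M i\<in>{..<d}. density lborel std_normal_density)"
  proof -
    have "distr (gauss (0::'a) 1) (\<Pi>\<^sub>M i\<in>{..<d}. density lborel std_normal_density) L
      = distr (\<Pi>\<^sub>M b\<in>(Basis::'a set). density lborel std_normal_density)
         (\<Pi>\<^sub>M i\<in>{..<d}. density lborel std_normal_density) (\<lambda>w. \<lambda>i\<in>{..<d}. w (e i))"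
      unfolding standard_gauss_eq_PiM
    proof (subst distr_distr)
      show "(\<lambda>w. \<Sum>b\<in>Basis. w b *\<^sub>R b) \<in> (\<Pi>\<^sub>M b\<in>(Basis::'a set). density lborel std_normal_density) \<rightarrow>\<^sub>M borel"
        by measurable
      have "L (\<Sum>b\<in>Basis. w b *\<^sub>R b) = (\<lambda>i\<in>{..<d}. w (e i))" for w
        using e(2) by (auto simp: L_def fun_eq_iff)
      then show "distr (\<Pi>\<^sub>M b\<in>(Basis::'a set). density lborel std_normal_density) (\<Pi>\<^sub>M i\<in>{..<d}. density lborel std_normal_density) (L \<circ> (\<lambda>w. \<Sum>b\<in>Basis. w b *\<^sub>R b)) =
        distr (\<Pi>\<^sub>M b\<in>(Basis::'a set). density lborel std_normal_density) (\<Pi>\<^sub>M i\<in>{..<d}. density lborel std_normal_density) (\<lambda>w. \<lambda>i\<in>{..<d}. w (e i))"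
        by (simp add: comp_def)
    qed (rule Ld)
    also have "\<dots> = (\<Pi>\<^sub>M i\<in>{..<d}. density lborel std_normal_density)"
      using e by (intro distr_PiM_reindex prob_space_normal_density) auto
    finally show ?thesis .
  qed
  have "distr (gauss m s) borel (\<lambda>x. norm (proj x) / s) = distr (gauss 0 1) borel (\<lambda>y. norm (proj (m + s *\<^sub>R g y)) / s)"
    by (subst gauss_eq_distr_standard[OF g s]) (simp add: distr_distr comp_def)
  also have "\<dots> = distr (gauss 0 1) borel (\<lambda>y. sqrt (\<Sum>i<d. (L y i)\<^sup>2))"
  proof (rule arg_cong[where f="distr _ _"], rule ext)
    fix y
    have "norm (proj (m + s *\<^sub>R g y)) / s = norm (proj (g y))"
      using s by (simp add: proj_add m proj_scaleR)
    also have "\<dots> = sqrt (\<Sum>i<d. (g y \<bullet> b i)\<^sup>2)"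
      by (simp flip: norm_proj_sq)
    also have "(\<Sum>i<d. (g y \<bullet> b i)\<^sup>2) = (\<Sum>i<d. (L y i)\<^sup>2)"
    proof (rule sum.cong)
      fix i assume "i \<in> {..<d}"
      then have "g y \<bullet> b i = y \<bullet> e i"
        using f fb[of i] fg[of y] by (metis lessThan_iff orthogonal_transformation_def)
      then show "(g y \<bullet> b i)\<^sup>2 = (L y i)\<^sup>2" using \<open>i \<in> {..<d}\<close> by (simp add: L_def)
    qed simp
    finally show "norm (proj (m + s *\<^sub>R g y)) / s = sqrt (\<Sum>i<d. (L y i)\<^sup>2)" .
  qed
  also have "\<dots> = distr (distr (gauss 0 1) (\<Pi>\<^sub>M i\<in>{..<d}. density lborel std_normal_density) L) borel (\<lambda>z. sqrt (\<Sum>i<d. (z i)\<^sup>2))"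
    by (subst distr_distr) (auto intro: Ld simp: comp_def)
  also have "\<dots> = chi d"
    unfolding L_distr chi_def chi_square_def by (subst distr_distr) (auto simp: comp_def)
  finally show ?thesis .
qed

lemma prob_space_chi: "prob_space (chi d)"
  by (subst norm_proj_distr_gauss[of 1 0, symmetric])
     (auto intro!: prob_space.prob_space_distr prob_space_gauss proj_eq_0)

text \<open>The set where the projection has norm at most \<open>r\<close> is convex, hence has a
  negligible frontier. The level set lies in that frontier, because a small outward push increases
  the norm.\<close>

lemma norm_proj_sphere_null:
  assumes d: "0 < d"
  shows "{x. norm (proj x) = r} \<in> null_sets lborel"
proof -
  let ?C = "{x. norm (proj x) \<le> r}"
  have "convex ?C"
  proof (rule convexI, clarify)
    fix x y :: 'a and u v :: real assume *: "norm (proj x) \<le> r" "norm (proj y) \<le> r" "0 \<le> u" "0 \<le> v" "u + v = 1"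
    have "norm (proj (u *\<^sub>R x + v *\<^sub>R y)) \<le> u * norm (proj x) + v * norm (proj y)"
      using *(3,4) norm_triangle_ineq[of "u *\<^sub>R proj x" "v *\<^sub>R proj y"] by (simp add: proj_add proj_scaleR)
    also have "\<dots> \<le> u * r + v * r"
      using * by (intro add_mono mult_left_mono) auto
    also have "\<dots> = r" using *(5) by (metis distrib_right mult_1)
    finally show "norm (proj (u *\<^sub>R x + v *\<^sub>R y)) \<le> r" .
  qed
  then have "negligible (frontier ?C)" by (rule negligible_convex_frontier)
  moreover have "{x. norm (proj x) = r} \<subseteq> frontier ?C"
  proof
    fix x assume "x \<in> {x. norm (proj x) = r}"
    then have x: "norm (proj x) = r" by simp
    \<comment> \<open>Where the projection is zero there is no radial direction; \<open>b 0\<close>,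
      a member of the family because \<open>0 < d\<close>, takes its place.\<close>
    define w where "w = (if proj x = 0 then b 0 else proj x)"
    have w: "proj w = w" "w \<noteq> 0" using d by (auto simp: w_def proj_basis proj_proj basis_nz)
    have gt: "norm (proj (x + t *\<^sub>R w)) > r" if "0 < t" for t
    proof (cases "proj x = 0")
      case True
      then show ?thesis using x that w by (simp add: proj_add proj_scaleR)
    next
      case False
      then have "proj (x + t *\<^sub>R w) = (1 + t) *\<^sub>R proj x"
        by (simp add: proj_add proj_scaleR w_def proj_proj algebra_simps)
      then show ?thesis using that False by (simp add: distrib_right flip: x)
    qed
    have "x \<notin> interior ?C"
    proof
      assume "x \<in> interior ?C"
      then obtain \<epsilon> where \<epsilon>: "0 < \<epsilon>" "cball x \<epsilon> \<subseteq> ?C"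
        unfolding mem_interior_cball by blast
      have "x + (\<epsilon> / norm w) *\<^sub>R w \<in> cball x \<epsilon>"
        using \<epsilon>(1) w by (simp add: dist_norm)
      with \<epsilon> gt[of "\<epsilon> / norm w"] w show False by auto
    qed
    moreover have "x \<in> closure ?C" using x closure_subset[of ?C] by auto
    ultimately show "x \<in> frontier ?C" by (simp add: frontier_def)
  qed
  ultimately have "negligible {x. norm (proj x) = r}" by (rule negligible_subset)
  then show ?thesis
    by (simp add: negligible_iff_null_sets null_sets_completion_iff)
qed

lemma gauss_norm_proj_sphere:
  assumes "0 < d"
  shows "AE x in gauss m s. norm (proj x) \<noteq> r"
proof -
  have "AE x in lborel. norm (proj x) \<noteq> r"
    using norm_proj_sphere_null[OF assms, of r] by (rule AE_not_in[THEN AE_mp]) simp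
  then show ?thesis
    unfolding gauss_def by (subst AE_density) auto
qed

text \<open>Abstract form of \<open>cond_stat\<close>. Where the projection is zero, the first
  component is zero by the convention \<open>1 / 0 = 0\<close>.\<close>

definition polar :: "'a \<Rightarrow> 'a \<times> 'a" where
  "polar x = ((1 / norm (proj x)) *\<^sub>R proj x, x - proj x)"

lemma borel_measurable_polar[measurable]: "polar \<in> borel_measurable borel"
  unfolding polar_def[abs_def] by measurable

lemma polar_stretch: "0 < r \<Longrightarrow> polar (stretch r x) = polar x"
  by (simp add: polar_def perp_stretch) (simp add: proj_stretch)

text \<open>
  For a set \<open>A\<close> of values of \<^term>\<open>polar\<close>, the law \<open>\<nu> A\<close> of the norm of the projection on
  \<open>polar x \<in> A\<close>, under the measure \<open>\<Lambda>\<close> that keeps only the Gaussian weight of the orthogonal part,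
  gives \<open>{..r}\<close> the mass \<open>r ^ d * a A\<close>. So all these laws are proportional to each other, which is
  the independence.
\<close>

lemma gauss_polar_independent:
  assumes d: "0 < d" and s: "0 < s" and m: "proj m = 0"
  shows "distr (gauss m s) (borel \<Otimes>\<^sub>M borel) (\<lambda>x. (polar x, norm (proj x) / s))
       = distr (gauss m s) borel polar \<Otimes>\<^sub>M chi d"
proof -
  interpret G: prob_space "gauss m s" using s by (rule prob_space_gauss)
  \<comment> \<open>\<open>w\<close> carries the orthogonal factor of the density and the whole
    normalising constant; \<open>E\<close> is the remaining radial factor.\<close>
  define w where "w x = exp (- (norm (x - proj x - m))\<^sup>2 / (2 * s\<^sup>2)) / sqrt (2 * pi * s\<^sup>2) ^ DIM('a)" for x
  define E where "E \<rho> = exp (- \<rho>\<^sup>2 / (2 * s\<^sup>2))" for \<rho> :: real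
  have [measurable]: "w \<in> borel_measurable borel" "E \<in> borel_measurable borel"
    unfolding w_def[abs_def] E_def[abs_def] by measurable
  have w0: "0 \<le> w x" and E0: "0 \<le> E \<rho>" for x \<rho> by (simp_all add: w_def E_def)
  have dens: "gauss_density m s x = E (norm (proj x)) * w x" for x
  proof -
    \<comment> \<open>Pythagoras applies because \<open>proj m = 0\<close>: the mean belongs
      entirely to the orthogonal part.\<close>
    have orth: "proj x \<bullet> (x - proj x - m) = 0"
      using inner_proj_proj[of "x - proj x - m" x] by (simp add: proj_diff proj_proj m inner_commute)
    have "(norm (x - m))\<^sup>2 = (norm (proj x + (x - proj x - m)))\<^sup>2" by simp
    also have "\<dots> = (norm (proj x))\<^sup>2 + (norm (x - proj x - m))\<^sup>2"
      using orth by (intro norm_add_Pythagorean) (simp add: orthogonal_def)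
    finally show ?thesis
      by (simp add: gauss_density_def E_def w_def diff_divide_distrib flip: exp_add)
  qed
  define \<Lambda> where "\<Lambda> = density lborel (\<lambda>x. ennreal (w x))"
  have [measurable_cong, simp]: "sets \<Lambda> = sets borel" and [simp]: "space \<Lambda> = UNIV" by (simp_all add: \<Lambda>_def)
  have gauss_\<Lambda>: "gauss m s = density \<Lambda> (\<lambda>x. ennreal (E (norm (proj x))))"
    unfolding gauss_def \<Lambda>_def dens by (subst density_density_eq) (auto simp: ennreal_mult w0 E0 mult.commute)
  \<comment> \<open>\<open>w\<close> sees only the orthogonal part, which \<open>stretch r\<close>
    fixes, so nothing but the Lebesgue factor appears.\<close>
  have scale: "emeasure \<Lambda> U = ennreal (r ^ d) * emeasure \<Lambda> (stretch r -` U)" if r: "0 < r" and [measurable]: "U \<in> sets borel" for r U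
  proof -
    have "emeasure \<Lambda> U = (\<integral>\<^sup>+x. ennreal (w x) * indicator U x \<partial>lborel)"
      unfolding \<Lambda>_def by (rule emeasure_density) auto
    also have "\<dots> = (\<integral>\<^sup>+x. ennreal (r ^ d) * (ennreal (w (stretch r x)) * indicator U (stretch r x)) \<partial>lborel)"
      by (subst lborel_stretch[OF r], subst nn_integral_density) (auto simp: nn_integral_distr)
    also have "\<dots> = ennreal (r ^ d) * (\<integral>\<^sup>+x. ennreal (w x) * indicator (stretch r -` U) x \<partial>lborel)"
      by (subst nn_integral_cmult) (auto simp: w_def perp_stretch indicator_def intro!: arg_cong[where f="(*) _"] nn_integral_cong)
    also have "(\<integral>\<^sup>+x. ennreal (w x) * indicator (stretch r -` U) x \<partial>lborel) = emeasure \<Lambda> (stretch r -` U)"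
      unfolding \<Lambda>_def using measurable_sets[OF borel_measurable_stretch, of U r]
      by (intro emeasure_density[symmetric]) auto
    finally show ?thesis .
  qed
  \<comment> \<open>Points with zero projection are left out, so that \<open>S A r\<close> is empty
    for \<open>r \<le> 0\<close>; under the Gaussian they form a null set.\<close>
  define S where "S A r = {x. polar x \<in> A \<and> proj x \<noteq> 0 \<and> norm (proj x) \<le> r}" for A r
  have S_meas[measurable]: "S A r \<in> sets borel" if [measurable]: "A \<in> sets borel" for A r
    unfolding S_def by measurable
  define a where "a A = emeasure \<Lambda> (S A 1)" for A
  have S_scale: "emeasure \<Lambda> (S A r) = ennreal (r ^ d) * a A" if r: "0 < r" and A: "A \<in> sets borel" for A r
  proof -
    have "stretch r -` S A r = S A 1"
      using r by (auto simp: S_def polar_stretch proj_stretch)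
    then show ?thesis using scale[OF r S_meas[OF A]] by (simp add: a_def)
  qed
  have a_fin: "a A \<noteq> \<infinity>" if "A \<in> sets borel" for A
  proof -
    have "a A = (\<integral>\<^sup>+x. indicator (S A 1) x \<partial>\<Lambda>)" using that by (simp add: a_def)
    \<comment> \<open>\<open>E\<close> decreases with the norm, so it is at least \<open>E 1\<close>
      on \<open>S A 1\<close>; the mass there is bounded by the Gaussian mass divided by
      \<open>E 1\<close>.\<close>
    also have "\<dots> \<le> (\<integral>\<^sup>+x. ennreal (1 / E 1) * ennreal (E (norm (proj x))) \<partial>\<Lambda>)"
    proof (rule nn_integral_mono)
      fix x
      have "1 \<le> 1 / E 1 * E (norm (proj x))" if "norm (proj x) \<le> 1"
      proof -
        have "(norm (proj x))\<^sup>2 \<le> 1" using that by (simp add: power_le_one)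
        then have "E 1 \<le> E (norm (proj x))" using s by (simp add: E_def divide_right_mono)
        then show ?thesis by (simp add: E_def field_simps)
      qed
      then show "indicator (S A 1) x \<le> ennreal (1 / E 1) * ennreal (E (norm (proj x)))"
        by (auto simp: indicator_def S_def E0 simp flip: ennreal_mult ennreal_1 intro!: ennreal_leI)
    qed
    also have "\<dots> = ennreal (1 / E 1) * (\<integral>\<^sup>+x. ennreal (E (norm (proj x))) \<partial>\<Lambda>)"
      by (rule nn_integral_cmult) simp
    also have "(\<integral>\<^sup>+x. ennreal (E (norm (proj x))) \<partial>\<Lambda>) = emeasure (gauss m s) UNIV"
      by (simp add: gauss_\<Lambda> emeasure_density)
    also have "\<dots> = 1" using G.emeasure_space_1 by simp
    finally show ?thesis by (auto simp: top_unique)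
  qed
  define \<nu> where "\<nu> A = distr (density \<Lambda> (indicator {x. polar x \<in> A \<and> proj x \<noteq> 0})) borel (\<lambda>x. norm (proj x))" for A
  have [measurable_cong, simp]: "sets (\<nu> A) = sets borel" and [simp]: "space (\<nu> A) = UNIV" for A by (simp_all add: \<nu>_def)
  have \<nu>_Iic: "emeasure (\<nu> A) {..r} = (if 0 < r then ennreal (r ^ d) * a A else 0)" if [measurable]: "A \<in> sets borel" for A r
  proof -
    have "emeasure (\<nu> A) {..r} = (\<integral>\<^sup>+x. indicator {x. polar x \<in> A \<and> proj x \<noteq> 0} x * indicator {x. norm (proj x) \<le> r} x \<partial>\<Lambda>)"
      unfolding \<nu>_def by (subst emeasure_distr, simp, simp) (simp add: vimage_def emeasure_density)
    also have "\<dots> = (\<integral>\<^sup>+x. indicator (S A r) x \<partial>\<Lambda>)"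
      by (rule nn_integral_cong) (auto simp: S_def indicator_def)
    also have "\<dots> = emeasure \<Lambda> (S A r)" by simp
    also have "\<dots> = (if 0 < r then ennreal (r ^ d) * a A else 0)"
    proof (cases "0 < r")
      case False
      then have "S A r = {}" by (auto simp: S_def) (meson norm_le_zero_iff order_trans not_le)
      with False show ?thesis by simp
    qed (simp add: S_scale)
    finally show ?thesis .
  qed
  \<comment> \<open>Cross-multiplied to avoid dividing by \<open>a\<close>, which may be zero. Both
    sides give \<open>{..r}\<close> with \<open>0 < r\<close> the mass
    \<open>r ^ d * a UNIV * a A\<close>, and half-lines generate the Borel sets.\<close>
  have proportional: "scale_measure (a UNIV) (\<nu> A) = scale_measure (a A) (\<nu> UNIV)" if A: "A \<in> sets borel" for A
  proof (rule measure_eqI_generator_eq[where E="range (\<lambda>r. {..r})" and \<Omega>=UNIV and A="\<lambda>n. {..real n}"])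
    show "Int_stable (range (\<lambda>r::real. {..r}))"
      by (auto simp: Int_stable_def)
    show "emeasure (scale_measure (a UNIV) (\<nu> A)) X = emeasure (scale_measure (a A) (\<nu> UNIV)) X" if "X \<in> range (\<lambda>r. {..r})" for X
      using that A by (auto simp: \<nu>_Iic ac_simps)
    show "sets (scale_measure (a UNIV) (\<nu> A)) = sigma_sets UNIV (range (\<lambda>r. {..r}))"
         "sets (scale_measure (a A) (\<nu> UNIV)) = sigma_sets UNIV (range (\<lambda>r. {..r}))"
      by (simp_all add: borel_eq_atMost)
    show "(\<Union>n. {..real n}) = UNIV" using real_arch_simple by auto
    show "emeasure (scale_measure (a UNIV) (\<nu> A)) {..real n} \<noteq> \<infinity>" for n
      using A a_fin[OF A] a_fin[of UNIV] by (auto simp: \<nu>_Iic ennreal_mult_eq_top_iff)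
  qed auto
  define P where "P B A = emeasure (gauss m s) {x. norm (proj x) / s \<in> B \<and> polar x \<in> A}" for B A
  define h where "h B \<rho> = ennreal (E \<rho>) * indicator B (\<rho> / s)" for B \<rho>
  have h[measurable]: "h B \<in> borel_measurable borel" if [measurable]: "B \<in> sets borel" for B
    unfolding h_def[abs_def] by measurable
  \<comment> \<open>\<open>\<nu> A\<close> lacks only the radial weight of the Gaussian, which
    \<open>h\<close> restores. The zero projections missing from \<open>\<nu> A\<close> have
    Gaussian probability zero, as \<open>0 < d\<close>.\<close>
  have P_eq: "P B A = (\<integral>\<^sup>+\<rho>. h B \<rho> \<partial>\<nu> A)" if [measurable]: "B \<in> sets borel" "A \<in> sets borel" for A B
  proof -
    have "P B A = emeasure (gauss m s) {x. norm (proj x) / s \<in> B \<and> polar x \<in> A \<and> proj x \<noteq> 0}"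
      unfolding P_def
      by (rule emeasure_eq_AE) (use gauss_norm_proj_sphere[OF d, where m=m and s=s and r=0] in \<open>auto elim!: AE_mp\<close>)
    also have "\<dots> = (\<integral>\<^sup>+x. ennreal (E (norm (proj x))) * indicator {x. norm (proj x) / s \<in> B \<and> polar x \<in> A \<and> proj x \<noteq> 0} x \<partial>\<Lambda>)"
      unfolding gauss_\<Lambda> by (rule emeasure_density) auto
    also have "\<dots> = (\<integral>\<^sup>+x. indicator {x. polar x \<in> A \<and> proj x \<noteq> 0} x * h B (norm (proj x)) \<partial>\<Lambda>)"
      by (rule nn_integral_cong) (auto simp: h_def indicator_def)
    also have "\<dots> = (\<integral>\<^sup>+\<rho>. h B \<rho> \<partial>\<nu> A)"
      unfolding \<nu>_def by (subst nn_integral_distr, simp, simp, subst nn_integral_density) auto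
    finally show ?thesis .
  qed
  have key: "a UNIV * P B A = a A * P B UNIV" if B: "B \<in> sets borel" and A: "A \<in> sets borel" for A B
  proof -
    have "a UNIV * P B A = (\<integral>\<^sup>+\<rho>. h B \<rho> \<partial>scale_measure (a UNIV) (\<nu> A))"
      using A B by (simp add: P_eq nn_integral_scale_measure)
    also have "\<dots> = a A * P B UNIV"
      using A B by (simp add: proportional P_eq nn_integral_scale_measure)
    finally show ?thesis .
  qed
  have P1: "P UNIV UNIV = 1" using G.emeasure_space_1 by (simp add: P_def)
  \<comment> \<open>Otherwise all half-lines would be null for \<open>\<nu> UNIV\<close>, and the
    total Gaussian probability would be an integral against the zero measure.\<close>
  have a_pos: "a UNIV \<noteq> 0"
  proof
    assume "a UNIV = 0"
    then have "emeasure (\<nu> UNIV) {..real n} = 0" for n by (simp add: \<nu>_Iic)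
    then have "(\<Union>n. {..real n}) \<in> null_sets (\<nu> UNIV)" by (intro null_sets_UN) auto
    moreover have "(\<Union>n. {..real n}) = UNIV" using real_arch_simple by auto
    ultimately have AE: "AE x in \<nu> UNIV. False" by (auto intro: AE_I')
    have "P UNIV UNIV = (\<integral>\<^sup>+\<rho>. h UNIV \<rho> \<partial>\<nu> UNIV)" by (rule P_eq) auto
    also have "\<dots> = (\<integral>\<^sup>+\<rho>. 0 \<partial>\<nu> UNIV)" by (rule nn_integral_cong_AE) (use AE in auto)
    finally have "P UNIV UNIV = 0" by simp
    then show False using P1 by simp
  qed
  \<comment> \<open>For \<open>B = UNIV\<close>, \<open>key\<close> reads
    \<open>a UNIV * P UNIV A = a A\<close>; inserting this into the general case and cancelling
    \<open>a UNIV\<close> gives the product rule.\<close>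
  have indep: "P B A = P B UNIV * P UNIV A" if "B \<in> sets borel" "A \<in> sets borel" for A B
  proof -
    have "a UNIV * P B A = (a UNIV * P UNIV A) * P B UNIV"
      using key[OF that] key[of UNIV A] that P1 by simp
    then have "a UNIV * P B A = a UNIV * (P B UNIV * P UNIV A)"
      by (simp only: mult.assoc mult.commute[of "P UNIV A"])
    then show ?thesis using a_pos a_fin[of UNIV] by (simp add: ennreal_mult_cancel_left)
  qed
  show ?thesis
  proof (rule pair_measure_eqI[symmetric])
    show "sigma_finite_measure (chi d)"
      by (rule prob_space_imp_sigma_finite[OF prob_space_chi])
    show "sigma_finite_measure (distr (gauss m s) borel polar)"
      by (intro prob_space_imp_sigma_finite G.prob_space_distr) auto
    show "sets (distr (gauss m s) borel polar \<Otimes>\<^sub>M chi d) = sets (distr (gauss m s) (borel \<Otimes>\<^sub>M borel) (\<lambda>x. (polar x, norm (proj x) / s)))"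
      by (simp add: chi_def cong: sets_pair_measure_cong)
    fix A B assume "A \<in> sets (distr (gauss m s) borel polar)" "B \<in> sets (chi d)"
    then have BA[measurable]: "B \<in> sets borel" "A \<in> sets borel" by (auto simp: chi_def)
    have "emeasure (chi d) B = P B UNIV"
      unfolding norm_proj_distr_gauss[OF s m, symmetric] P_def
      by (subst emeasure_distr) (auto intro!: arg_cong[where f="emeasure _"])
    moreover have "emeasure (distr (gauss m s) borel polar) A = P UNIV A"
      unfolding P_def by (subst emeasure_distr) (auto intro!: arg_cong[where f="emeasure _"])
    moreover have "emeasure (distr (gauss m s) (borel \<Otimes>\<^sub>M borel) (\<lambda>x. (polar x, norm (proj x) / s))) (A \<times> B) = P B A"
      unfolding P_def by (subst emeasure_distr) (auto intro!: arg_cong[where f="emeasure _"])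
    ultimately show "emeasure (distr (gauss m s) borel polar) A * emeasure (chi d) B =
       emeasure (distr (gauss m s) (borel \<Otimes>\<^sub>M borel) (\<lambda>x. (polar x, norm (proj x) / s))) (A \<times> B)"
      using indep[OF BA] by (metis mult.commute)
  qed
qed

text \<open>The law is that of the norm of a projected standard Gaussian, and the level sets of that
  norm are null when \<open>0 < d\<close>.\<close>

lemma measure_chi_singleton:
  assumes "0 < d"
  shows "measure (chi d) {t} = 0"
proof -
  have "AE x in gauss (0::'a) 1. norm (proj x) \<noteq> t"
    using assms by (rule gauss_norm_proj_sphere)
  then have "emeasure (gauss (0::'a) 1) {x. norm (proj x) = t} = 0"
    by (subst (asm) AE_iff_measurable[OF _ refl]) auto
  then have "emeasure (distr (gauss (0::'a) 1) borel (\<lambda>x. norm (proj x) / 1)) {t} = 0"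
    by (subst emeasure_distr) (auto simp: vimage_def)
  then show ?thesis
    by (subst (asm) norm_proj_distr_gauss) (auto simp: measure_def intro: proj_eq_0)
qed

end

subsection \<open>Conditioning on a slice\<close>

text \<open>The distribution function is continuous but may have flat stretches, so it need not be
  invertible. The least point \<open>t0\<close> where it reaches \<open>1 - \<alpha>\<close> serves
  instead: the event is the half-line from \<open>t0\<close> on.\<close>

lemma (in real_distribution) prob_integral_transform:
  assumes atomless: "\<And>x. measure M {x} = 0" and \<alpha>: "0 < \<alpha>" "\<alpha> < 1"
  shows "measure M {t. 1 - cdf M t \<le> \<alpha>} = \<alpha>"
proof -
  define \<beta> where "\<beta> = 1 - \<alpha>"
  define R where "R = {t. \<beta> \<le> cdf M t}"
  have cont: "continuous_on A (cdf M)" for A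
    using isCont_cdf atomless by (intro continuous_at_imp_continuous_on) auto
  have "\<forall>\<^sub>F t in at_bot. cdf M t < \<beta>"
    using cdf_lim_at_bot \<alpha> by (intro order_tendstoD) (auto simp: \<beta>_def)
  then obtain l where l: "cdf M l < \<beta>" by (auto simp: eventually_at_bot_linorder)
  have "\<forall>\<^sub>F t in at_top. \<beta> < cdf M t"
    using cdf_lim_at_top_prob \<alpha> by (intro order_tendstoD) (auto simp: \<beta>_def)
  then obtain u where u: "\<beta> < cdf M u" by (auto simp: eventually_at_top_linorder)
  have "l \<le> u"
    using l u cdf_nondecreasing[of u l] by (cases "l \<le> u") auto
  then obtain t1 where t1: "cdf M t1 = \<beta>"
    using IVT'[of "cdf M" l \<beta> u] l u cont by auto
  have lower: "l \<le> t" if "t \<in> R" for t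
    using that l cdf_nondecreasing[of t l] by (cases "l \<le> t") (auto simp: R_def)
  have bdd: "bdd_below R" using lower by (rule bdd_belowI)
  have "R = cdf M -` {\<beta>..}" by (auto simp: R_def)
  then have "closed R" using continuous_closed_vimage[of "{\<beta>..}" "cdf M"] cont[of UNIV]
    by (simp add: continuous_on_eq_continuous_at)
  define t0 where "t0 = Inf R"
  have "t1 \<in> R" by (simp add: R_def t1)
  then have "t0 \<in> R" unfolding t0_def using bdd \<open>closed R\<close> by (intro closed_contains_Inf) auto
  moreover have "t0 \<le> t1" unfolding t0_def using \<open>t1 \<in> R\<close> bdd by (rule cInf_lower)
  ultimately have t0: "cdf M t0 = \<beta>"
    using cdf_nondecreasing[of t0 t1] t1 by (simp add: R_def)
  have "t0 \<le> t" if "t \<in> R" for t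
    unfolding t0_def using that bdd by (rule cInf_lower)
  then have "R = {t0..}"
    using cdf_nondecreasing[of t0] t0 by (auto simp: R_def)
  then have "R = space M - {..t0} \<union> {t0}" by auto
  then have "measure M R = measure M (space M - {..t0}) + measure M {t0}"
    by (simp only:) (rule finite_measure_Union, auto)
  also have "\<dots> = 1 - cdf M t0" using atomless prob_compl[of "{..t0}"] by (simp add: cdf_def)
  finally have "measure M R = \<alpha>" by (simp add: t0 \<beta>_def)
  moreover have "{t. 1 - cdf M t \<le> \<alpha>} = R" by (auto simp: R_def \<beta>_def)
  ultimately show ?thesis by simp
qed

text \<open>A difference at \<open>t\<close> would persist just to the right of \<open>t\<close>,
  where there are rationals. Countably many thresholds are what almost-everywhere statements can be
  combined over.\<close>

lemma cdf_eqI_rat: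
  assumes "real_distribution M" "real_distribution N"
    and eq: "\<And>q::rat. cdf M (of_rat q) = cdf N (of_rat q)"
  shows "cdf M = cdf N"
proof
  interpret M: real_distribution M by fact
  interpret N: real_distribution N by fact
  fix t
  show "cdf M t = cdf N t"
  proof (rule ccontr)
    assume ne: "cdf M t \<noteq> cdf N t"
    have "((\<lambda>x. cdf M x - cdf N x) \<longlongrightarrow> cdf M t - cdf N t) (at_right t)"
      using M.cdf_is_right_cont[of t] N.cdf_is_right_cont[of t]
      by (intro tendsto_diff) (auto simp: continuous_within)
    then have "\<forall>\<^sub>F x in at_right t. cdf M x - cdf N x \<noteq> 0"
      by (rule tendsto_imp_eventually_ne) (use ne in auto)
    then obtain b where b: "t < b" "\<And>x. t < x \<Longrightarrow> x < b \<Longrightarrow> cdf M x - cdf N x \<noteq> 0"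
      by (auto simp: eventually_at_right[of t "t + 1"])
    obtain q where "t < of_rat q" "of_rat q < b" using of_rat_dense[OF b(1)] by auto
    then show False using b(2) eq[of q] by auto
  qed
qed

text \<open>Keeps of the Gaussian setting only what conditioning uses: \<open>joint_distr\<close>
  says that \<open>T\<close> has law \<open>\<rho>\<close> and is independent of \<open>Z\<close>,
  and the event is read off from the pair through \<open>D\<close>.\<close>

locale conditioning_on_slice = prob_space M for M :: "'w measure" +
  fixes T :: "'w \<Rightarrow> real" and Z :: "'w \<Rightarrow> 'z" and MZ :: "'z measure" and \<rho> :: "real measure"
    and D :: "('z \<times> real) set"
  assumes T_measurable[measurable]: "T \<in> borel_measurable M"
    and Z_measurable[measurable]: "Z \<in> M \<rightarrow>\<^sub>M MZ"
    and prob_\<rho>: "prob_space \<rho>" and sets_\<rho>[measurable_cong, simp]: "sets \<rho> = sets borel"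
    and joint_distr: "distr M (MZ \<Otimes>\<^sub>M borel) (\<lambda>\<omega>. (Z \<omega>, T \<omega>)) = distr M MZ Z \<Otimes>\<^sub>M \<rho>"
    and D_sets[measurable]: "D \<in> sets (MZ \<Otimes>\<^sub>M borel)"
    and event_pos: "0 < measure M {\<omega> \<in> space M. (Z \<omega>, T \<omega>) \<in> D}"
begin

sublocale \<rho>: prob_space \<rho> by (rule prob_\<rho>)

lemma space_\<rho>[simp]: "space \<rho> = UNIV"
  using sets_eq_imp_space_eq[OF sets_\<rho>] by simp

definition event :: "'w set" where "event = {\<omega> \<in> space M. (Z \<omega>, T \<omega>) \<in> D}"

definition slice :: "'z \<Rightarrow> real set" where "slice z = Pair z -` D"

text \<open>The Dirac measure is a filler on slices of measure zero.\<close>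

definition kernel :: "'z \<Rightarrow> real measure" where
  "kernel z = (if measure \<rho> (slice z) = 0 then return borel 0 else uniform_measure \<rho> (slice z))"

abbreviation cond_measure :: "'w measure" where "cond_measure \<equiv> uniform_measure M event"

lemma event_sets[measurable]: "event \<in> sets M"
  unfolding event_def by measurable

lemma slice_sets[measurable]: "slice z \<in> sets borel"
  unfolding slice_def using D_sets by (rule sets_Pair1)

lemma emeasure_event: "emeasure M event \<noteq> 0" "emeasure M event \<noteq> \<infinity>"
  using event_pos by (auto simp: event_def emeasure_eq_measure)

lemma prob_cond_measure: "prob_space cond_measure"
  using emeasure_event by (rule prob_space_uniform_measure)

lemma sets_kernel[simp, measurable_cong]: "sets (kernel z) = sets borel"
  by (simp add: kernel_def)

lemma prob_kernel: "prob_space (kernel z)"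
  by (auto simp: kernel_def \<rho>.emeasure_eq_measure intro!: prob_space_return prob_space_uniform_measure)

lemma emeasure_kernel: "B \<in> sets borel \<Longrightarrow>
    emeasure (kernel z) B = (if measure \<rho> (slice z) = 0 then indicator B 0 else emeasure \<rho> (slice z \<inter> B) / emeasure \<rho> (slice z))"
  by (simp add: kernel_def)

text \<open>A division-free description of the conditional law. It covers null slices, where both
  sides are zero, so later integrations over \<open>Z\<close> need no case distinction.\<close>

lemma emeasure_kernel_mult:
  assumes [measurable]: "B \<in> sets borel"
  shows "emeasure (kernel z) B * emeasure \<rho> (slice z) = emeasure \<rho> (slice z \<inter> B)"
proof (cases "measure \<rho> (slice z) = 0")
  case True
  have "emeasure \<rho> (slice z \<inter> B) \<le> emeasure \<rho> (slice z)" by (rule emeasure_mono) auto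
  with True show ?thesis by (simp add: \<rho>.emeasure_eq_measure)
next
  case False
  then show ?thesis
    by (simp add: emeasure_kernel \<rho>.emeasure_eq_measure divide_ennreal measure_nonneg zero_less_measure_iff flip: ennreal_mult)
qed

lemma measurable_emeasure_slice[measurable]:
  assumes [measurable]: "B \<in> sets borel"
  shows "(\<lambda>z. emeasure \<rho> (slice z \<inter> B)) \<in> borel_measurable MZ"
proof -
  have "(\<lambda>z. emeasure \<rho> (Pair z -` (D \<inter> (space MZ \<times> B)))) \<in> borel_measurable MZ"
    by (rule \<rho>.measurable_emeasure_Pair) measurable
  then show ?thesis
    by (rule measurable_cong[THEN iffD1, rotated]) (auto simp: slice_def intro!: arg_cong[where f="emeasure \<rho>"])
qed

lemma kernel_measurable[measurable]: "kernel \<in> MZ \<rightarrow>\<^sub>M prob_algebra borel"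
proof (intro measurable_prob_algebraI measurable_subprob_algebra)
  have [measurable]: "(\<lambda>z. emeasure \<rho> (slice z)) \<in> borel_measurable MZ"
    using measurable_emeasure_slice[of UNIV] by simp
  show "(\<lambda>z. emeasure (kernel z) B) \<in> borel_measurable MZ" if [measurable]: "B \<in> sets borel" for B
    unfolding emeasure_kernel[OF that] measure_def by measurable
qed (auto intro: prob_kernel prob_space_imp_subprob_space)

lemma real_distribution_kernel: "real_distribution (kernel z)"
  using prob_kernel[of z] sets_eq_imp_space_eq[OF sets_kernel[of z]]
  by (simp add: real_distribution_def real_distribution_axioms_def)

lemma nn_integral_joint:
  assumes [measurable]: "f \<in> borel_measurable (MZ \<Otimes>\<^sub>M borel)"
  shows "(\<integral>\<^sup>+\<omega>. f (Z \<omega>, T \<omega>) \<partial>M) = (\<integral>\<^sup>+z. (\<integral>\<^sup>+t. f (z, t) \<partial>\<rho>) \<partial>distr M MZ Z)"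
proof -
  have "(\<integral>\<^sup>+\<omega>. f (Z \<omega>, T \<omega>) \<partial>M) = (\<integral>\<^sup>+x. f x \<partial>distr M (MZ \<Otimes>\<^sub>M borel) (\<lambda>\<omega>. (Z \<omega>, T \<omega>)))"
    by (subst nn_integral_distr) auto
  also have "\<dots> = (\<integral>\<^sup>+z. (\<integral>\<^sup>+t. f (z, t) \<partial>\<rho>) \<partial>distr M MZ Z)"
    unfolding joint_distr by (rule \<rho>.nn_integral_fst[symmetric]) simp
  finally show ?thesis .
qed

text \<open>By this use of Fubini, an identity under the conditional measure can be checked on each
  slice separately.\<close>

lemma nn_integral_cond_measure:
  assumes [measurable]: "f \<in> borel_measurable (MZ \<Otimes>\<^sub>M borel)"
  shows "(\<integral>\<^sup>+\<omega>. f (Z \<omega>, T \<omega>) \<partial>cond_measure)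
    = (\<integral>\<^sup>+z. (\<integral>\<^sup>+t. f (z, t) * indicator (slice z) t \<partial>\<rho>) \<partial>distr M MZ Z) / emeasure M event"
proof -
  have "(\<integral>\<^sup>+\<omega>. f (Z \<omega>, T \<omega>) \<partial>cond_measure) = (\<integral>\<^sup>+\<omega>. f (Z \<omega>, T \<omega>) * indicator event \<omega> \<partial>M) / emeasure M event"
    by (rule nn_integral_uniform_measure) auto
  also have "(\<integral>\<^sup>+\<omega>. f (Z \<omega>, T \<omega>) * indicator event \<omega> \<partial>M) = (\<integral>\<^sup>+\<omega>. f (Z \<omega>, T \<omega>) * indicator D (Z \<omega>, T \<omega>) \<partial>M)"
    by (rule nn_integral_cong) (auto simp: event_def indicator_def)
  also have "\<dots> = (\<integral>\<^sup>+z. (\<integral>\<^sup>+t. f (z, t) * indicator D (z, t) \<partial>\<rho>) \<partial>distr M MZ Z)"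
    by (subst nn_integral_joint[where f="\<lambda>x. f x * indicator D x"]) auto
  also have "\<dots> = (\<integral>\<^sup>+z. (\<integral>\<^sup>+t. f (z, t) * indicator (slice z) t \<partial>\<rho>) \<partial>distr M MZ Z)"
    by (intro nn_integral_cong) (auto simp: slice_def indicator_def)
  finally show ?thesis .
qed

text \<open>Integrals over a null slice vanish, so the event almost never occurs together with a
  value of \<open>Z\<close> whose slice is null.\<close>

lemma AE_slice_pos: "AE \<omega> in cond_measure. measure \<rho> (slice (Z \<omega>)) \<noteq> 0"
proof -
  have [measurable]: "(\<lambda>z. measure \<rho> (slice z)) \<in> borel_measurable MZ"
    unfolding measure_def using measurable_emeasure_slice[of UNIV] by simp
  define f where "f x = (if measure \<rho> (slice (fst x)) = 0 then 1 else 0 :: ennreal)" for x :: "'z \<times> real"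
  have [measurable]: "f \<in> borel_measurable (MZ \<Otimes>\<^sub>M borel)"
    unfolding f_def[abs_def] by measurable
  have "(\<integral>\<^sup>+t. f (z, t) * indicator (slice z) t \<partial>\<rho>) = 0" for z
  proof -
    have "(\<integral>\<^sup>+t. f (z, t) * indicator (slice z) t \<partial>\<rho>) = f (z, 0) * emeasure \<rho> (slice z)"
      by (subst nn_integral_indicator[symmetric], simp, subst nn_integral_cmult[symmetric]) (auto simp: f_def)
    then show ?thesis by (auto simp: f_def \<rho>.emeasure_eq_measure)
  qed
  then have "(\<integral>\<^sup>+\<omega>. f (Z \<omega>, T \<omega>) \<partial>cond_measure) = 0"
    unfolding nn_integral_cond_measure[OF \<open>f \<in> _\<close>] by simp
  moreover have "(\<lambda>\<omega>. f (Z \<omega>, T \<omega>)) \<in> borel_measurable cond_measure" by simp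
  ultimately have "AE \<omega> in cond_measure. f (Z \<omega>, T \<omega>) = 0"
    by (simp add: nn_integral_0_iff_AE)
  then show ?thesis by (rule AE_mp) (auto simp: f_def indicator_def)
qed

abbreviation sigma_Z :: "'w measure" where "sigma_Z \<equiv> vimage_algebra (space M) Z MZ"

lemma subalgebra_sigma_Z: "subalgebra M sigma_Z"
  unfolding subalgebra_def using measurable_sets[OF Z_measurable] measurable_space[OF Z_measurable]
  by (auto simp: sets_vimage_algebra2[of Z])

lemma subalgebra_cond_measure: "subalgebra cond_measure sigma_Z"
  using subalgebra_sigma_Z by (simp add: subalgebra_def)

text \<open>Sets of \<open>sigma_Z\<close> are preimages under \<open>Z\<close>, so the averaging
  identity that characterises conditional expectation reduces, slice by slice, to
  \<open>emeasure_kernel_mult\<close>.\<close>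

lemma regular_cond_distr_kernel: "regular_cond_distr cond_measure sigma_Z T (\<lambda>\<omega>. kernel (Z \<omega>))"
  unfolding regular_cond_distr_def
proof (intro conjI ballI)
  interpret N: prob_space cond_measure by (rule prob_cond_measure)
  interpret sigma_finite_subalgebra cond_measure sigma_Z
    by (intro finite_measure_subalgebra_is_sigma_finite) (auto simp: finite_measure_subalgebra_def finite_measure_subalgebra_axioms_def subalgebra_cond_measure intro: N.finite_measure_axioms)
  have ZF[measurable]: "Z \<in> sigma_Z \<rightarrow>\<^sub>M MZ"
    using measurable_space[OF Z_measurable] by (intro measurable_vimage_algebra1) auto
  show "(\<lambda>\<omega>. kernel (Z \<omega>)) \<in> sigma_Z \<rightarrow>\<^sub>M prob_algebra borel"
    by measurable
  fix B :: "real set" assume B[measurable]: "B \<in> sets borel"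
  have km[measurable]: "(\<lambda>z. measure (kernel z) B) \<in> borel_measurable MZ"
    using measurable_prob_algebraD[OF kernel_measurable]
    unfolding measure_def by (intro borel_measurable_enn2real emeasure_measurable_subprob_algebra2) auto
  have kb: "measure (kernel z) B \<le> 1" for z
    using prob_space.prob_le_1[OF prob_kernel] .
  have "AE \<omega> in cond_measure. real_cond_exp cond_measure sigma_Z (\<lambda>\<omega>'. indicator B (T \<omega>')) \<omega> = measure (kernel (Z \<omega>)) B"
  proof (rule real_cond_exp_charact)
    fix A assume A: "A \<in> sets sigma_Z"
    then obtain A' where A'[measurable]: "A' \<in> sets MZ" and A_eq: "A = Z -` A' \<inter> space M"
      using measurable_space[OF Z_measurable] by (auto simp: sets_vimage_algebra2[of Z])
    have [measurable]: "A \<in> sets M" using A subalgebra_sigma_Z by (auto simp: subalgebra_def)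
    \<comment> \<open>The two integrands of the averaging identity over \<open>A\<close>, as
      functions of the pair \<open>(Z, T)\<close>; they are kept nonnegative so that the slice
      formula applies.\<close>
    define f1 f2 where "f1 = (\<lambda>(z, t). indicator A' z * indicator B t :: ennreal)"
      and "f2 = (\<lambda>(z, t :: real). indicator A' z * ennreal (measure (kernel z) B))"
    have [measurable]: "f1 \<in> borel_measurable (MZ \<Otimes>\<^sub>M borel)" "f2 \<in> borel_measurable (MZ \<Otimes>\<^sub>M borel)"
      unfolding f1_def f2_def by measurable
    have "(\<integral>\<^sup>+\<omega>. f1 (Z \<omega>, T \<omega>) \<partial>cond_measure) = (\<integral>\<^sup>+\<omega>. f2 (Z \<omega>, T \<omega>) \<partial>cond_measure)"
      unfolding nn_integral_cond_measure[OF \<open>f1 \<in> _\<close>] nn_integral_cond_measure[OF \<open>f2 \<in> _\<close>]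
    proof (intro arg_cong2[where f="(/)"] refl, rule nn_integral_cong)
      fix z
      interpret k: prob_space "kernel z" by (rule prob_kernel)
      have "(\<integral>\<^sup>+t. f1 (z, t) * indicator (slice z) t \<partial>\<rho>) = (\<integral>\<^sup>+t. indicator A' z * indicator (slice z \<inter> B) t \<partial>\<rho>)"
        by (rule nn_integral_cong) (auto simp: f1_def indicator_def)
      also have "\<dots> = indicator A' z * emeasure \<rho> (slice z \<inter> B)"
        by (simp add: nn_integral_cmult)
      also have "\<dots> = (indicator A' z * emeasure (kernel z) B) * emeasure \<rho> (slice z)"
        by (simp add: emeasure_kernel_mult mult.assoc)
      also have "\<dots> = (\<integral>\<^sup>+t. f2 (z, t) * indicator (slice z) t \<partial>\<rho>)"
        by (simp add: f2_def nn_integral_cmult k.emeasure_eq_measure)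
      finally show "(\<integral>\<^sup>+t. f1 (z, t) * indicator (slice z) t \<partial>\<rho>) = (\<integral>\<^sup>+t. f2 (z, t) * indicator (slice z) t \<partial>\<rho>)" .
    qed
    moreover have "(\<integral>\<omega>\<in>A. indicator B (T \<omega>) \<partial>cond_measure) = enn2real (\<integral>\<^sup>+\<omega>. f1 (Z \<omega>, T \<omega>) \<partial>cond_measure)"
      unfolding set_lebesgue_integral_def
      by (subst integral_eq_nn_integral)
         (auto intro!: arg_cong[where f=enn2real] nn_integral_cong simp: f1_def A_eq indicator_def)
    moreover have "(\<integral>\<omega>\<in>A. measure (kernel (Z \<omega>)) B \<partial>cond_measure) = enn2real (\<integral>\<^sup>+\<omega>. f2 (Z \<omega>, T \<omega>) \<partial>cond_measure)"
      unfolding set_lebesgue_integral_def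
      by (subst integral_eq_nn_integral)
         (auto intro!: arg_cong[where f=enn2real] nn_integral_cong simp: f2_def A_eq indicator_def)
    ultimately show "(\<integral>\<omega>\<in>A. indicator B (T \<omega>) \<partial>cond_measure) = (\<integral>\<omega>\<in>A. measure (kernel (Z \<omega>)) B \<partial>cond_measure)"
      by simp
  next
    show "integrable cond_measure (\<lambda>\<omega>. indicator B (T \<omega>) :: real)"
      by (rule N.integrable_const_bound[where B=1]) (auto simp: indicator_def)
    show "integrable cond_measure (\<lambda>\<omega>. measure (kernel (Z \<omega>)) B)"
      by (rule N.integrable_const_bound[where B=1]) (auto simp: kb)
    show "(\<lambda>\<omega>. measure (kernel (Z \<omega>)) B) \<in> borel_measurable sigma_Z"
      by (rule measurable_compose[OF ZF km])
  qed
  then show "AE \<omega> in cond_measure. measure (kernel (Z \<omega>)) B = real_cond_exp cond_measure sigma_Z (\<lambda>\<omega>'. indicator B (T \<omega>')) \<omega>"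
    by (rule AE_mp) auto
qed

text \<open>At each rational threshold both sides are versions of the same conditional probability.
  Countably many null sets are discarded, and right continuity yields one null set valid for all
  thresholds.\<close>

lemma AE_cdf_eq_kernel:
  assumes \<kappa>: "regular_cond_distr cond_measure sigma_Z T \<kappa>"
  shows "AE \<omega> in cond_measure. cdf (\<kappa> \<omega>) = cdf (kernel (Z \<omega>))"
proof -
  have "AE \<omega> in cond_measure. measure (\<kappa> \<omega>) {..of_rat q} = measure (kernel (Z \<omega>)) {..of_rat q}" for q :: rat
  proof -
    have "AE \<omega> in cond_measure. measure (\<kappa> \<omega>) {..of_rat q} = real_cond_exp cond_measure sigma_Z (\<lambda>\<omega>'. indicator {..of_rat q} (T \<omega>')) \<omega>"
         "AE \<omega> in cond_measure. measure (kernel (Z \<omega>)) {..of_rat q} = real_cond_exp cond_measure sigma_Z (\<lambda>\<omega>'. indicator {..of_rat q} (T \<omega>')) \<omega>"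
      using \<kappa> regular_cond_distr_kernel by (auto simp: regular_cond_distr_def)
    then show ?thesis by eventually_elim simp
  qed
  then have "AE \<omega> in cond_measure. \<forall>q::rat. measure (\<kappa> \<omega>) {..of_rat q} = measure (kernel (Z \<omega>)) {..of_rat q}"
    by (simp add: AE_all_countable)
  moreover have "AE \<omega> in cond_measure. real_distribution (\<kappa> \<omega>)"
  proof (rule AE_I2)
    fix \<omega> assume "\<omega> \<in> space cond_measure"
    then have "\<kappa> \<omega> \<in> space (prob_algebra borel)"
      using \<kappa> by (auto simp: regular_cond_distr_def dest!: measurable_space)
    then show "real_distribution (\<kappa> \<omega>)"
      by (auto simp: space_prob_algebra real_distribution_def real_distribution_axioms_def dest: sets_eq_imp_space_eq)
  qed
  ultimately show ?thesis
    by eventually_elim (intro cdf_eqI_rat real_distribution_kernel, auto simp: cdf_def)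
qed

text \<open>Law and threshold vary together: the value is the \<open>\<kappa> x\<close>-mass of the
  section at \<open>x\<close> of the measurable region on and below the graph of
  \<open>g\<close>.\<close>

lemma measurable_cdf_kernel:
  assumes \<kappa>: "\<kappa> \<in> L \<rightarrow>\<^sub>M prob_algebra borel" and g[measurable]: "g \<in> borel_measurable L"
  shows "(\<lambda>x. cdf (\<kappa> x) (g x)) \<in> borel_measurable L"
proof -
  have "(SIGMA x:space L. {..g x}) = {p \<in> space (L \<Otimes>\<^sub>M borel). snd p \<le> g (fst p)}"
    by (auto simp: space_pair_measure)
  also have "\<dots> \<in> sets (L \<Otimes>\<^sub>M borel)" by measurable
  finally show ?thesis
    unfolding cdf_def measure_def
    by (intro borel_measurable_enn2real emeasure_measurable_subprob_algebra2[where N=borel] measurable_prob_algebraD[OF \<kappa>])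
qed

text \<open>Once \<open>\<kappa>\<close> is replaced by \<open>kernel\<close>, the integral
  transform gives level \<alpha> on every slice of positive mass, and averaging the slices over
  \<open>Z\<close> keeps that level.\<close>

lemma p_value_uniform:
  assumes \<kappa>: "regular_cond_distr cond_measure sigma_Z T \<kappa>"
    and atomless: "\<And>t. measure \<rho> {t} = 0" and \<alpha>: "0 < \<alpha>" "\<alpha> < 1"
  shows "measure M {\<omega> \<in> space M. 1 - cdf (\<kappa> \<omega>) (T \<omega>) \<le> \<alpha> \<and> \<omega> \<in> event} / measure M event = \<alpha>"
proof -
  interpret N: prob_space cond_measure by (rule prob_cond_measure)
  have \<kappa>M: "\<kappa> \<in> M \<rightarrow>\<^sub>M prob_algebra borel"
    using \<kappa> measurable_from_subalg[OF subalgebra_sigma_Z] by (auto simp: regular_cond_distr_def)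
  have [measurable]: "(\<lambda>\<omega>. cdf (\<kappa> \<omega>) (T \<omega>)) \<in> borel_measurable M"
    by (rule measurable_cdf_kernel[OF \<kappa>M]) simp
  have [measurable]: "(\<lambda>x. cdf (kernel (fst x)) (snd x)) \<in> borel_measurable (MZ \<Otimes>\<^sub>M borel)"
    by (rule measurable_cdf_kernel) auto
  define f where "f x = (if 1 - cdf (kernel (fst x)) (snd x) \<le> \<alpha> then 1 else 0 :: ennreal)" for x
  have [measurable]: "f \<in> borel_measurable (MZ \<Otimes>\<^sub>M borel)" unfolding f_def[abs_def] by measurable
  have slice_eq: "(\<integral>\<^sup>+t. f (z, t) * indicator (slice z) t \<partial>\<rho>) = ennreal \<alpha> * emeasure \<rho> (slice z)" for z
  proof -
    interpret k: real_distribution "kernel z" by (rule real_distribution_kernel)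
    let ?R = "{t. 1 - cdf (kernel z) t \<le> \<alpha>}"
    have [measurable]: "cdf (kernel z) \<in> borel_measurable borel"
      using k.cdf_nondecreasing by (intro borel_measurable_mono monoI)
    have R[measurable]: "?R \<in> sets borel" by measurable
    have "(\<integral>\<^sup>+t. f (z, t) * indicator (slice z) t \<partial>\<rho>) = (\<integral>\<^sup>+t. indicator (slice z \<inter> ?R) t \<partial>\<rho>)"
      by (rule nn_integral_cong) (auto simp: f_def indicator_def)
    also have "\<dots> = emeasure (kernel z) ?R * emeasure \<rho> (slice z)"
      by (simp add: emeasure_kernel_mult)
    also have "\<dots> = ennreal \<alpha> * emeasure \<rho> (slice z)"
    \<comment> \<open>On a null slice both sides vanish; on any other the kernel inherits from
      \<open>\<rho>\<close> the absence of atoms.\<close>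
    proof (cases "measure \<rho> (slice z) = 0")
      case False
      have "measure (kernel z) {t} = 0" for t
      proof -
        have "emeasure \<rho> (slice z \<inter> {t}) \<le> emeasure \<rho> {t}" by (rule emeasure_mono) auto
        then have "emeasure \<rho> (slice z \<inter> {t}) = 0" using atomless[of t] by (simp add: \<rho>.emeasure_eq_measure)
        then show ?thesis using False by (simp add: measure_def emeasure_kernel del: emeasure_eq_0)
      qed
      then have "measure (kernel z) ?R = \<alpha>" using \<alpha> by (intro k.prob_integral_transform)
      then show ?thesis by (simp add: k.emeasure_eq_measure)
    qed (simp add: \<rho>.emeasure_eq_measure)
    finally show ?thesis .
  qed
  \<comment> \<open>The slice formula for the constant 1: the slice masses average to the
    probability of the event.\<close>
  have "(\<integral>\<^sup>+z. emeasure \<rho> (slice z) \<partial>distr M MZ Z) / emeasure M event = (\<integral>\<^sup>+\<omega>. 1 \<partial>cond_measure)"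
    by (subst nn_integral_cond_measure[where f="\<lambda>_. 1"]) auto
  also have "\<dots> = 1" using N.emeasure_space_1 by simp
  finally have total: "(\<integral>\<^sup>+z. emeasure \<rho> (slice z) \<partial>distr M MZ Z) / emeasure M event = 1" .
  let ?A = "{\<omega> \<in> space M. 1 - cdf (\<kappa> \<omega>) (T \<omega>) \<le> \<alpha>}"
  have "emeasure cond_measure ?A = (\<integral>\<^sup>+\<omega>. indicator ?A \<omega> \<partial>cond_measure)" by simp
  also have "\<dots> = (\<integral>\<^sup>+\<omega>. f (Z \<omega>, T \<omega>) \<partial>cond_measure)"
    using AE_cdf_eq_kernel[OF \<kappa>] AE_space
    by (intro nn_integral_cong_AE, eventually_elim) (auto simp: f_def indicator_def)
  also have "\<dots> = (\<integral>\<^sup>+z. ennreal \<alpha> * emeasure \<rho> (slice z) \<partial>distr M MZ Z) / emeasure M event"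
    by (simp add: nn_integral_cond_measure slice_eq)
  also have "\<dots> = ennreal \<alpha> * ((\<integral>\<^sup>+z. emeasure \<rho> (slice z) \<partial>distr M MZ Z) / emeasure M event)"
    using measurable_emeasure_slice[of UNIV] by (subst nn_integral_cmult) (auto simp: ennreal_times_divide)
  finally have "emeasure cond_measure ?A = ennreal \<alpha>" by (simp add: total)
  then have "measure cond_measure ?A = \<alpha>" using \<alpha> by (simp add: measure_def)
  then have "measure M (event \<inter> ?A) / measure M event = \<alpha>"
    using emeasure_event by (subst (asm) measure_uniform_measure) auto
  moreover have "event \<inter> ?A = {\<omega> \<in> space M. 1 - cdf (\<kappa> \<omega>) (T \<omega>) \<le> \<alpha> \<and> \<omega> \<in> event}" by auto
  ultimately show ?thesis by simp
qed

end

subsection \<open>The clustering event and the contrast space\<close>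

lemma borel_measurable_vec_nth[measurable]:
  "(\<lambda>A :: 'a::euclidean_space^'n. A $ i) \<in> borel_measurable borel"
  by (intro borel_measurable_continuous_onI continuous_intros)

lemma nearest_centers_eq_iff:
  "S \<subseteq> {1..K} \<Longrightarrow> nearest_centers K m x = S \<longleftrightarrow>
     (\<forall>k\<in>{1..K}. k \<in> S \<longleftrightarrow> (\<forall>l\<in>{1..K}. norm (x - m k) \<le> norm (x - m l)))"
  unfolding nearest_centers_def by blast

text \<open>The values lie in a finite discrete space, so any tie rule can be composed with the map.
  Each value is attained on a finite Boolean combination of comparisons of distances.\<close>

lemma nearest_centers_measurable:
  fixes m :: "nat \<Rightarrow> 'a::topological_space \<Rightarrow> real^'q"
  assumes [measurable]: "\<And>l. m l \<in> borel_measurable borel" "x \<in> borel_measurable borel"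
  shows "(\<lambda>A. nearest_centers K (\<lambda>l. m l A) (x A)) \<in> borel \<rightarrow>\<^sub>M count_space (Pow {1..K})"
  unfolding measurable_count_space_eq2[OF finite_Pow_iff[THEN iffD2, OF finite_atLeastAtMost]]
proof (intro conjI ballI)
  show "(\<lambda>A. nearest_centers K (\<lambda>l. m l A) (x A)) \<in> space borel \<rightarrow> Pow {1..K}"
    by (auto simp: nearest_centers_def)
  fix S assume "S \<in> Pow {1..K}"
  then have "(\<lambda>A. nearest_centers K (\<lambda>l. m l A) (x A)) -` {S} \<inter> space borel =
     {A \<in> space borel. \<forall>k\<in>{1..K}. k \<in> S \<longleftrightarrow> (\<forall>l\<in>{1..K}. norm (x A - m k A) \<le> norm (x A - m l A))}"
    by (simp add: vimage_def nearest_centers_eq_iff)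
  also have "\<dots> \<in> sets borel" by measurable
  finally show "(\<lambda>A. nearest_centers K (\<lambda>l. m l A) (x A)) -` {S} \<inter> space borel \<in> sets borel" .
qed

text \<open>The next centers depend on the data also through the previous assignment. Fixing that
  assignment \<open>h\<close> makes them averages over fixed clusters, and there are only countably
  many \<open>h\<close>, being functions from a finite type to the naturals.\<close>

lemma kmeans_assign_event_sets:
  "{A :: real^'q^'n. kmeans_assign K init tb A j = g} \<in> sets borel"
proof (induction j arbitrary: g)
  case 0
  have [measurable]: "(\<lambda>A :: real^'q^'n. nearest_centers K (\<lambda>l. A $ init l) (A $ i)) \<in> borel \<rightarrow>\<^sub>M count_space (Pow {1..K})" for i
    by (rule nearest_centers_measurable) auto
  have "{A \<in> space borel. \<forall>i. tb 0 i (nearest_centers K (\<lambda>l. (A :: real^'q^'n) $ init l) (A $ i)) = g i} \<in> sets borel"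
    by measurable
  then show ?case by (simp add: fun_eq_iff)
next
  case (Suc j)
  have cont: "(\<lambda>A :: real^'q^'n. row_mean A C) \<in> borel_measurable borel" for C
    unfolding row_mean_def by measurable
  have [measurable]: "(\<lambda>A :: real^'q^'n. nearest_centers K (\<lambda>l. row_mean A {s. h s = l}) (A $ i)) \<in> borel \<rightarrow>\<^sub>M count_space (Pow {1..K})" for i h
    by (rule nearest_centers_measurable) (auto intro: cont)
  have *: "{A \<in> space borel. \<forall>i. tb (Suc j) i (nearest_centers K (\<lambda>l. row_mean (A :: real^'q^'n) {s. h s = l}) (A $ i)) = g i} \<in> sets borel" for h
    by measurable
  have "{A :: real^'q^'n. kmeans_assign K init tb A (Suc j) = g} =
     (\<Union>h. {A. kmeans_assign K init tb A j = h} \<inter>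
        {A \<in> space borel. \<forall>i. tb (Suc j) i (nearest_centers K (\<lambda>l. row_mean A {s. h s = l}) (A $ i)) = g i})"
    by (auto simp: fun_eq_iff)
  also have "\<dots> \<in> sets borel"
    using Suc.IH * by (intro sets.countable_UN) auto
  finally show ?case .
qed

text \<open>Once the assignments agree with \<open>c\<close>, the nonemptiness test concerns
  \<open>c\<close> alone, so the event is either empty or a finite intersection of assignment
  events.\<close>

lemma kmeans_event_sets: "{A :: real^'q^'n. kmeans K J init tb A = Some c} \<in> sets borel"
proof -
  have "{A :: real^'q^'n. kmeans K J init tb A = Some c} =
    (if length c = Suc J \<and> (\<forall>j\<le>J. \<forall>k\<in>{1..K}. \<exists>i. (c ! j) i = k)
     then (\<Inter>j\<in>{..J}. {A. kmeans_assign K init tb A j = c ! j}) else {})" (is "?L = ?R")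
  proof (rule set_eqI)
    fix A :: "real^'q^'n"
    let ?a = "kmeans_assign K init tb A"
    have "map ?a [0..<Suc J] = c \<longleftrightarrow> length c = Suc J \<and> (\<forall>j\<le>J. ?a j = c ! j)"
      by (auto simp: list_eq_iff_nth_eq less_Suc_eq_le simp del: upt_Suc)
    then have L: "A \<in> ?L \<longleftrightarrow> (\<forall>j\<le>J. \<forall>k\<in>{1..K}. \<exists>i. ?a j i = k) \<and> length c = Suc J \<and> (\<forall>j\<le>J. ?a j = c ! j)"
      by (simp add: kmeans_def del: upt_Suc)
    have R0: "(\<forall>j\<in>{..J}. ?a j = c ! j) \<longleftrightarrow> (\<forall>j\<le>J. ?a j = c ! j)" by auto
    have R: "A \<in> ?R \<longleftrightarrow> (length c = Suc J \<and> (\<forall>j\<le>J. \<forall>k\<in>{1..K}. \<exists>i. (c ! j) i = k)) \<and> (\<forall>j\<le>J. ?a j = c ! j)"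
      by (simp add: R0)
    show "A \<in> ?L \<longleftrightarrow> A \<in> ?R"
    proof (cases "\<forall>j\<le>J. ?a j = c ! j")
      case True
      then have eq: "(\<forall>j\<le>J. \<forall>k\<in>{1..K}. \<exists>i. ?a j i = k) \<longleftrightarrow> (\<forall>j\<le>J. \<forall>k\<in>{1..K}. \<exists>i. (c ! j) i = k)"
        by simp
      show ?thesis unfolding L R eq by blast
    next
      case False
      then show ?thesis unfolding L R by blast
    qed
  qed
  also have "\<dots> \<in> sets borel"
    using kmeans_assign_event_sets by (auto intro!: sets.finite_INT)
  finally show ?thesis .
qed

lemma kmeans_final_cluster_nonempty:
  assumes "kmeans K J init tb A = Some c" "k \<in> {1..K}"
  shows "final_cluster J c k \<noteq> {}"
proof -
  have c: "c = map (kmeans_assign K init tb A) [0..<Suc J]" and "\<exists>i. kmeans_assign K init tb A J i = k"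
    using assms by (auto simp: kmeans_def simp del: upt_Suc split: if_splits)
  moreover have "c ! J = kmeans_assign K init tb A J"
    unfolding c by (simp del: upt_Suc)
  ultimately show ?thesis by (auto simp: final_cluster_def)
qed

section \<open>The contrast space and the projection onto matrices with columns in it\<close>

lemma subspace_contrast_space: "subspace (contrast_space V C)"
  by (simp add: contrast_space_def)

text \<open>Disjointness prevents cancellation: at an index in \<open>C k\<close> the contrast
  vector has the entry \<open>1 / card (C k)\<close>.\<close>

lemma dim_contrast_space_pos:
  assumes "(k, k') \<in> V" "C k \<noteq> {}" "C k \<inter> C k' = {}"
  shows "0 < dim (contrast_space V C)"
proof -
  obtain i where i: "i \<in> C k" using assms by auto
  then have "i \<notin> C k'" using assms by auto
  have "contrast_vec (C k) (C k') $ i \<noteq> 0"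
    using i \<open>i \<notin> C k'\<close> by (auto simp: contrast_vec_def)
  moreover have "contrast_vec (C k) (C k') \<in> contrast_space V C"
    unfolding contrast_space_def using assms(1) by (intro span_base) auto
  ultimately have "\<not> contrast_space V C \<subseteq> {0}" by auto
  then show ?thesis using dim_eq_0[of "contrast_space V C"] by auto
qed

text \<open>Turns the null hypothesis, an equality of mean vectors, into orthogonality of the
  columns of \<open>\<mu>\<close> to the generators of the contrast space.\<close>

lemma inner_column_contrast_vec:
  "column j A \<bullet> contrast_vec C C' = (row_mean A C - row_mean A C') $ j"
proof -
  have "(\<Sum>i\<in>UNIV. A $ i $ j * indicator S i / r) = (\<Sum>i\<in>S. A $ i $ j / r)" for S and r :: real
    by (rule sum.mono_neutral_cong_right) auto
  then show ?thesis
    by (simp add: contrast_vec_def row_mean_def inner_vec_def column_def right_diff_distrib sum_subtractf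
        sum_divide_distrib)
qed

lemma column_orthogonal_contrast_space:
  assumes "\<And>k k'. (k, k') \<in> V \<Longrightarrow> row_mean A (C k) = row_mean A (C k')"
    and "e \<in> contrast_space V C"
  shows "column j A \<bullet> e = 0"
  using assms(2) unfolding contrast_space_def
proof (induction rule: span_induct)
  case base
  show ?case by (simp add: subspace_def inner_add_right)
next
  case (step x)
  then show ?case using assms(1) by (auto simp: inner_column_contrast_vec)
qed

lemma orthonormal_expansion:
  assumes "finite B" and on: "\<And>u v. u \<in> B \<Longrightarrow> v \<in> B \<Longrightarrow> u \<bullet> v = (if u = v then 1 else 0)"
    and "x \<in> span B"
  shows "x = (\<Sum>e\<in>B. (x \<bullet> e) *\<^sub>R e)"
  using assms(3)
proof (induction rule: span_induct_alt)
  case (step c u y)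
  have "(\<Sum>e\<in>B. (u \<bullet> e) *\<^sub>R e) = (\<Sum>e\<in>B. if e = u then e else 0)"
    using step(1) on by (intro sum.cong) auto
  then have "(\<Sum>e\<in>B. (u \<bullet> e) *\<^sub>R e) = u"
    using step(1) assms(1) by simp
  then show ?case using step(2)
    by (simp add: inner_add_left scaleR_left_distrib sum.distrib flip: scaleR_scaleR scaleR_sum_right)
qed simp

text \<open>The residual is orthogonal to \<open>B\<close>, so the projection has the same
  coefficients as \<open>x\<close>. The properties of the description \<open>proj_mat\<close> come
  from \<open>proj_mat_exists_unique\<close>.\<close>

lemma proj_mat_orthonormal:
  fixes E :: "(real^'n) set"
  assumes E: "subspace E" "finite B" "span B = E"
    and on: "\<And>u v. u \<in> B \<Longrightarrow> v \<in> B \<Longrightarrow> u \<bullet> v = (if u = v then 1 else 0)"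
  shows "proj_mat E *v x = (\<Sum>e\<in>B. (x \<bullet> e) *\<^sub>R e)"
proof -
  have P: "proj_mat E *v x \<in> E \<and> (\<forall>y\<in>E. (x - proj_mat E *v x) \<bullet> y = 0)"
    using theI'[OF proj_mat_exists_unique[OF E(1)]] unfolding proj_mat_def by blast
  then have "proj_mat E *v x = (\<Sum>e\<in>B. ((proj_mat E *v x) \<bullet> e) *\<^sub>R e)"
    using E by (intro orthonormal_expansion[OF E(2) on]) auto
  also have "\<dots> = (\<Sum>e\<in>B. (x \<bullet> e) *\<^sub>R e)"
  proof (rule sum.cong)
    fix e assume "e \<in> B"
    then have "e \<in> E" using E(3) span_base by auto
    then have "(x - proj_mat E *v x) \<bullet> e = 0" using P by auto
    then show "((proj_mat E *v x) \<bullet> e) *\<^sub>R e = (x \<bullet> e) *\<^sub>R e" by (simp add: inner_diff_left)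
  qed simp
  finally show ?thesis .
qed

lemma matrix_mult_component_column: "(P ** A) $ i $ j = (P *v column j A) $ i"
  by (simp add: matrix_matrix_mult_def matrix_vector_mult_def column_def)

text \<open>The family consists of the matrices with one column from an orthonormal basis of
  \<open>E\<close> and zeros elsewhere, whence the count \<open>CARD('q) * dim E\<close>. The last
  conclusion links them to \<open>E\<close>, where the null hypothesis is available.\<close>

lemma proj_mat_orthonormal_family:
  fixes E :: "(real^'n) set"
  assumes E: "subspace E"
  obtains b :: "nat \<Rightarrow> real^'q^'n" where "orthonormal_family b (CARD('q) * dim E)"
    "\<And>A. orthonormal_family.proj b (CARD('q) * dim E) A = proj_mat E ** A"
    "\<And>n. n < CARD('q) * dim E \<Longrightarrow> \<exists>e\<in>E. \<exists>j. \<forall>A. A \<bullet> b n = column j A \<bullet> e"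
proof -
  obtain B where B: "B \<subseteq> E" "pairwise orthogonal B" "\<And>x. x \<in> B \<Longrightarrow> norm x = 1" "independent B"
     "card B = dim E" "span B = E"
    using orthonormal_basis_subspace[OF E] by metis
  have fin: "finite B" using B(4) by (rule independent_imp_finite)
  have on: "u \<bullet> v = (if u = v then 1 else 0)" if "u \<in> B" "v \<in> B" for u v
    using that B(2,3) by (auto simp: pairwise_def orthogonal_def norm_eq_1)
  let ?d = "CARD('q) * dim E"
  define F where "F p = (\<chi> i k. if k = snd p then fst p $ i else 0)" for p :: "(real^'n) \<times> 'q"
  have inner_F: "A \<bullet> F (e, j) = column j A \<bullet> e" for A e j
    by (simp add: F_def inner_vec_def column_def if_distrib[of "(*) _"] cong: if_cong)
  have column_F: "column j (F (e, j')) = (if j = j' then e else 0)" for e j j'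
    by (auto simp: F_def column_def vec_eq_iff)
  have card: "card (B \<times> (UNIV :: 'q set)) = ?d" using B(5) by (simp add: card_cartesian_product)
  obtain h where "bij_betw h {0..<card (B \<times> (UNIV :: 'q set))} (B \<times> (UNIV :: 'q set))"
    using ex_bij_betw_nat_finite[of "B \<times> (UNIV :: 'q set)"] fin by auto
  then have h: "bij_betw h {..<?d} (B \<times> (UNIV :: 'q set))"
    unfolding card by (simp only: atLeast0LessThan)
  define b where "b n = F (h n)" for n
  have hB: "fst (h n) \<in> B" if "n < ?d" for n
    using bij_betwE[OF h] that by (auto simp: mem_Times_iff)
  have inner_b: "A \<bullet> b n = column (snd (h n)) A \<bullet> fst (h n)" for A n
    unfolding b_def using inner_F[of A "fst (h n)" "snd (h n)"] by simp
  have column_b: "column j (b n) = (if j = snd (h n) then fst (h n) else 0)" for j n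
    unfolding b_def using column_F[of j "fst (h n)" "snd (h n)"] by simp
  interpret orthonormal_family b ?d
  proof
    fix m n assume mn: "m < ?d" "n < ?d"
    then have "h m = h n \<longleftrightarrow> m = n" using h by (auto simp: bij_betw_def inj_on_def)
    then show "b m \<bullet> b n = (if m = n then 1 else 0)"
      using mn by (auto simp: inner_b column_b on hB prod_eq_iff)
  qed
  have "proj A = proj_mat E ** A" for A
  proof -
    have "proj A $ i $ k = (proj_mat E ** A) $ i $ k" for i k
    proof -
      have "proj A = (\<Sum>p\<in>B \<times> UNIV. (column (snd p) A \<bullet> fst p) *\<^sub>R F p)"
        unfolding proj_def inner_b unfolding b_def
        by (rule sum.reindex_bij_betw[OF h, of "\<lambda>p. (column (snd p) A \<bullet> fst p) *\<^sub>R F p"])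
      also have "\<dots> = (\<Sum>e\<in>B. \<Sum>j\<in>UNIV. (column j A \<bullet> e) *\<^sub>R F (e, j))"
        by (simp add: sum.cartesian_product split_beta)
      finally have "proj A $ i $ k = (\<Sum>e\<in>B. \<Sum>j\<in>UNIV. (column j A \<bullet> e) * F (e, j) $ i $ k)"
        by simp
      also have "\<dots> = (\<Sum>e\<in>B. (column k A \<bullet> e) * e $ i)"
        by (simp add: F_def if_distrib[of "(*) _"] cong: if_cong)
      also have "\<dots> = (proj_mat E *v column k A) $ i"
        by (simp add: proj_mat_orthonormal[OF E fin B(6) on])
      finally show ?thesis by (simp add: matrix_mult_component_column)
    qed
    then show ?thesis by (simp add: vec_eq_iff)
  qed
  moreover have "\<exists>e\<in>E. \<exists>j. \<forall>A. A \<bullet> b n = column j A \<bullet> e" if "n < ?d" for n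
    using hB[OF that] B(1) inner_b by blast
  ultimately show ?thesis
    using that orthonormal_family_axioms by blast
qed

lemma proj_perp_mult: "proj_perp E ** A = A - proj_mat E ** A"
  by (simp add: vec_eq_iff matrix_mult_component_column proj_perp_def matrix_vector_mult_diff_rdistrib column_def)

text \<open>Independence makes the law of the tuple of rows a product measure; assembling the rows
  then gives a Gaussian matrix by \<open>gauss_vec_eq_distr_PiM\<close>.\<close>

lemma distr_rows_eq_gauss:
  fixes X :: "'w \<Rightarrow> real^'q^'n"
  assumes "prob_space M" and s: "0 < s"
    and indep: "prob_space.indep_vars M (\<lambda>_. borel) (\<lambda>i \<omega>. X \<omega> $ i) UNIV"
    and normal: "\<And>i. distributed M lborel (\<lambda>\<omega>. X \<omega> $ i) (\<lambda>x. ennreal (isotropic_normal_density (\<mu> $ i) s x))"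
  shows "X \<in> borel_measurable M" "distr M borel X = gauss \<mu> s"
proof -
  interpret prob_space M by fact
  have rv[measurable]: "(\<lambda>\<omega>. X \<omega> $ i) \<in> borel_measurable M" for i
    using distributed_measurable[OF normal[of i]] by simp
  have rows[measurable]: "(\<lambda>\<omega>. \<lambda>i\<in>UNIV. X \<omega> $ i) \<in> M \<rightarrow>\<^sub>M (\<Pi>\<^sub>M i\<in>UNIV. borel)"
    by measurable
  have X_eq: "X = (\<lambda>\<omega>. vec_lambda (\<lambda>i\<in>UNIV. X \<omega> $ i))"
    by (simp add: fun_eq_iff vec_eq_iff)
  show X: "X \<in> borel_measurable M"
    by (subst X_eq) measurable
  have row: "distr M borel (\<lambda>\<omega>. X \<omega> $ i) = gauss (\<mu> $ i) s" for i
  proof -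
    have "distr M borel (\<lambda>\<omega>. X \<omega> $ i) = distr M lborel (\<lambda>\<omega>. X \<omega> $ i)"
      by (rule distr_cong) auto
    also have "\<dots> = density lborel (\<lambda>x. ennreal (isotropic_normal_density (\<mu> $ i) s x))"
      by (rule distributed_distr_eq_density[OF normal])
    also have "\<dots> = gauss (\<mu> $ i) s"
      by (simp add: gauss_def gauss_density_def isotropic_normal_density_def)
    finally show ?thesis .
  qed
  have "distr M borel X = distr M borel (\<lambda>\<omega>. vec_lambda (\<lambda>i\<in>UNIV. X \<omega> $ i))"
    by (rule distr_cong) (auto simp: vec_eq_iff)
  also have "\<dots> = distr (distr M (\<Pi>\<^sub>M i\<in>UNIV. borel) (\<lambda>\<omega>. \<lambda>i\<in>UNIV. X \<omega> $ i)) borel vec_lambda"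
    by (subst distr_distr) (auto simp: comp_def)
  also have "distr M (\<Pi>\<^sub>M i\<in>UNIV. borel) (\<lambda>\<omega>. \<lambda>i\<in>UNIV. X \<omega> $ i) = (\<Pi>\<^sub>M i\<in>UNIV. distr M borel (\<lambda>\<omega>. X \<omega> $ i))"
    using indep rv by (subst indep_vars_iff_distr_eq_PiM'[symmetric]) auto
  also have "distr \<dots> borel vec_lambda = gauss \<mu> s"
    unfolding row using gauss_vec_eq_distr_PiM[OF s, of \<mu>] by simp
  finally show "distr M borel X = gauss \<mu> s" .
qed

theorem theorem1:
  fixes M :: "'w measure"
    and X :: "'w \<Rightarrow> real^'q^'n"
    and \<mu> :: "real^'q^'n"
    and \<sigma> :: real
    and K J :: nat
    and init :: "nat \<Rightarrow> 'n"
    and tb :: "nat \<Rightarrow> 'n \<Rightarrow> nat set \<Rightarrow> nat"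
    and V :: "(nat \<times> nat) set"
    and c :: "('n \<Rightarrow> nat) list"
  assumes "prob_space M"
    and "0 < J" and "2 \<le> K" and "K \<le> CARD('n)" and "0 < \<sigma>"
    and rows_indep: "prob_space.indep_vars M (\<lambda>_. borel) (\<lambda>i \<omega>. X \<omega> $ i) UNIV"
    and rows_normal: "\<And>i. distributed M lborel (\<lambda>\<omega>. X \<omega> $ i)
                            (\<lambda>x. ennreal (isotropic_normal_density (\<mu> $ i) \<sigma> x))"
    and "inj_on init {1..K}"
    and "tie_rule K tb"
    and "V \<subseteq> all_pairs K" and "V \<noteq> {}"
    and pos: "\<P>(\<omega> in M. kmeans K J init tb (X \<omega>) = Some c) > 0"
    and null_hyp: "\<And>k k'. (k, k') \<in> V \<Longrightarrow>
                     row_mean \<mu> (final_cluster J c k) = row_mean \<mu> (final_cluster J c k')"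
  shows "let E = contrast_space V (final_cluster J c);
             N = uniform_measure M {\<omega> \<in> space M. kmeans K J init tb (X \<omega>) = Some c};
             T = (\<lambda>\<omega>. test_stat \<sigma> E (X \<omega>));
             Z = (\<lambda>\<omega>. cond_stat E (X \<omega>));
             F = vimage_algebra (space M) Z borel;
             S = (\<lambda>\<omega>. truncation_set (kmeans K J init tb) \<sigma> E (X \<omega>));
             d = CARD('q) * dim E
         in (\<exists>\<kappa>. regular_cond_distr N F T \<kappa>) \<and>
            (\<forall>\<kappa>. regular_cond_distr N F T \<kappa> \<longrightarrow>
               (AE \<omega> in N. cdf (\<kappa> \<omega>) = (\<lambda>t. \<P>(w in chi d. w \<le> t \<bar> w \<in> S \<omega>))) \<and>
               (\<forall>\<alpha>. 0 < \<alpha> \<and> \<alpha> < 1 \<longrightarrow>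
                  \<P>(\<omega> in M. 1 - cdf (\<kappa> \<omega>) (T \<omega>) \<le> \<alpha> \<bar> kmeans K J init tb (X \<omega>) = Some c) = \<alpha>))"
proof -
  interpret M: prob_space M by fact
  define E where "E = contrast_space V (final_cluster J c)"
  define d where "d = CARD('q) * dim E"
  define f where "f = (kmeans K J init tb :: real^'q^'n \<Rightarrow> _)"
  define G where "G = {A. f A = Some c}"
  have G[measurable]: "G \<in> sets borel"
    unfolding G_def f_def by (rule kmeans_event_sets)
  have X[measurable]: "X \<in> borel_measurable M" and X_distr: "distr M borel X = gauss \<mu> \<sigma>"
    using distr_rows_eq_gauss[OF assms(1) \<open>0 < \<sigma>\<close> rows_indep rows_normal] by auto
  \<comment> \<open>An outcome of positive probability is produced by some realisation, and a run
    with value \<open>Some c\<close> has no empty cluster.\<close>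
  have nonempty: "final_cluster J c k \<noteq> {}" if "k \<in> {1..K}" for k
  proof -
    have "{\<omega> \<in> space M. kmeans K J init tb (X \<omega>) = Some c} \<noteq> {}"
    proof
      assume "{\<omega> \<in> space M. kmeans K J init tb (X \<omega>) = Some c} = {}"
      then show False using pos by (metis less_irrefl measure_empty)
    qed
    then show ?thesis using kmeans_final_cluster_nonempty that by blast
  qed
  have sub: "subspace E" unfolding E_def by (rule subspace_contrast_space)
  have "0 < dim E"
  proof -
    obtain k k' where kk': "(k, k') \<in> V" using \<open>V \<noteq> {}\<close> by auto
    then have "k \<in> {1..K}" "k \<noteq> k'" using \<open>V \<subseteq> all_pairs K\<close> by (auto simp: all_pairs_def)
    then show ?thesis
      unfolding E_def using nonempty by (intro dim_contrast_space_pos[OF kk']) (auto simp: final_cluster_def)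
  qed
  then have d: "0 < d" by (simp add: d_def)
  obtain b :: "nat \<Rightarrow> real^'q^'n" where b: "orthonormal_family b d"
    and proj_eq: "\<And>A. orthonormal_family.proj b d A = proj_mat E ** A"
    and b_col: "\<And>n. n < d \<Longrightarrow> \<exists>e\<in>E. \<exists>j. \<forall>A. A \<bullet> b n = column j A \<bullet> e"
    using proj_mat_orthonormal_family[OF sub] unfolding d_def by metis
  interpret O: orthonormal_family b d by (rule b)
  \<comment> \<open>Pairing with \<open>b n\<close> is pairing one column of \<open>\<mu>\<close>
    with a vector of \<open>E\<close>, which the null hypothesis makes zero.\<close>
  have "\<mu> \<bullet> b n = 0" if "n < d" for n
    using b_col[OF that] column_orthogonal_contrast_space[of V \<mu> "final_cluster J c"] null_hyp
    by (metis E_def)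
  then have \<mu>0: "O.proj \<mu> = 0" by (rule O.proj_eq_0)
  have Z_eq: "cond_stat E = O.polar"
    by (simp add: fun_eq_iff cond_stat_def O.polar_def proj_eq proj_perp_mult)
  have T_eq: "test_stat \<sigma> E = (\<lambda>A. norm (O.proj A) / \<sigma>)"
    by (simp add: fun_eq_iff test_stat_def proj_eq)
  define T where "T \<omega> = norm (O.proj (X \<omega>)) / \<sigma>" for \<omega>
  define Z where "Z \<omega> = O.polar (X \<omega>)" for \<omega>
  \<comment> \<open>The pair is turned back into a matrix; the factor \<open>\<sigma>\<close> undoes
    the division in \<open>T\<close>. The condition \<open>0 \<le> t\<close> mirrors the one in
    \<open>truncation_set\<close>.\<close>
  define D where "D = {(z, t). 0 \<le> t \<and> (\<sigma> * t) *\<^sub>R fst z + snd z \<in> G}"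
  have perturbed_eq: "perturbed \<sigma> E A \<psi> = (\<sigma> * \<psi>) *\<^sub>R fst (O.polar A) + snd (O.polar A)" for A \<psi>
    by (simp add: perturbed_def O.polar_def proj_eq proj_perp_mult mult.commute)
  \<comment> \<open>This includes the case \<open>P\<^sub>E X = 0\<close>, where \<open>1 / 0 = 0\<close> makes the first component of \<open>Z\<close> vanish.\<close>
  have X_eq: "(\<sigma> * T \<omega>) *\<^sub>R fst (Z \<omega>) + snd (Z \<omega>) = X \<omega>" for \<omega>
    using \<open>0 < \<sigma>\<close> by (cases "O.proj (X \<omega>) = 0") (auto simp: T_def Z_def O.polar_def)
  have mem_D: "(Z \<omega>, T \<omega>) \<in> D \<longleftrightarrow> f (X \<omega>) = Some c" for \<omega>
    using \<open>0 < \<sigma>\<close> by (simp add: D_def X_eq G_def) (simp add: T_def)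
  have [measurable]: "T \<in> borel_measurable M" "Z \<in> borel_measurable M"
    unfolding T_def[abs_def] Z_def[abs_def] by measurable
  interpret C: conditioning_on_slice M T Z borel "chi d" D
  proof (intro conditioning_on_slice.intro conditioning_on_slice_axioms.intro)
    show "prob_space M" by fact
    show "T \<in> borel_measurable M" "Z \<in> borel_measurable M" by measurable
    show "prob_space (chi d)" by (rule O.prob_space_chi)
    show "sets (chi d) = sets borel" by (simp add: chi_def)
    have "distr M (borel \<Otimes>\<^sub>M borel) (\<lambda>\<omega>. (Z \<omega>, T \<omega>)) = distr (distr M borel X) (borel \<Otimes>\<^sub>M borel) (\<lambda>x. (O.polar x, norm (O.proj x) / \<sigma>))"
      by (subst distr_distr) (auto simp: comp_def Z_def T_def)
    also have "\<dots> = distr (distr M borel X) borel O.polar \<Otimes>\<^sub>M chi d"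
      unfolding X_distr by (rule O.gauss_polar_independent[OF d \<open>0 < \<sigma>\<close> \<mu>0])
    also have "distr (distr M borel X) borel O.polar = distr M borel Z"
      by (subst distr_distr) (auto simp: comp_def Z_def[abs_def])
    finally show "distr M (borel \<Otimes>\<^sub>M borel) (\<lambda>\<omega>. (Z \<omega>, T \<omega>)) = distr M borel Z \<Otimes>\<^sub>M chi d" .
    have "D = {x \<in> space (borel \<Otimes>\<^sub>M borel). 0 \<le> snd x \<and> (\<sigma> * snd x) *\<^sub>R fst (fst x) + snd (fst x) \<in> G}"
      by (auto simp: D_def space_pair_measure)
    also have "\<dots> \<in> sets (borel \<Otimes>\<^sub>M borel)"
      unfolding borel_prod[symmetric] by measurable
    finally show "D \<in> sets (borel \<Otimes>\<^sub>M borel)" .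
    show "0 < measure M {\<omega> \<in> space M. (Z \<omega>, T \<omega>) \<in> D}"
      using pos by (simp add: mem_D f_def)
  qed
  have event_eq: "{\<omega> \<in> space M. kmeans K J init tb (X \<omega>) = Some c} = C.event"
    by (simp add: C.event_def mem_D f_def)
  have slice_iff: "\<psi> \<in> C.slice z \<longleftrightarrow> 0 \<le> \<psi> \<and> (\<sigma> * \<psi>) *\<^sub>R fst z + snd z \<in> G" for \<psi> z
    unfolding C.slice_def by (simp add: D_def)
  \<comment> \<open>On the event, comparison with the observed outcome is comparison with
    \<open>c\<close>, so there the truncation set depends on the data through \<open>Z\<close>
    alone.\<close>
  have S_eq: "truncation_set f \<sigma> E (X \<omega>) = C.slice (Z \<omega>)" if "f (X \<omega>) = Some c" for \<omega>
    using that by (auto simp: truncation_set_def slice_iff perturbed_eq Z_def G_def)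
  have in_event: "AE \<omega> in C.cond_measure. \<omega> \<in> C.event"
    by (rule AE_uniform_measureI) auto
  have cdf_kernel: "AE \<omega> in C.cond_measure. cdf (C.kernel (Z \<omega>)) = (\<lambda>t. \<P>(w in chi d. w \<le> t \<bar> w \<in> truncation_set f \<sigma> E (X \<omega>)))"
    using C.AE_slice_pos in_event
  proof eventually_elim
    case (elim \<omega>)
    then have S: "truncation_set f \<sigma> E (X \<omega>) = C.slice (Z \<omega>)"
      by (intro S_eq) (auto simp: C.event_def mem_D)
    \<comment> \<open>The slice has positive mass here, so \<open>kernel\<close> is the truncated
      law and not the Dirac filler.\<close>
    have "cdf (C.kernel (Z \<omega>)) t = measure (chi d) (C.slice (Z \<omega>) \<inter> {..t}) / measure (chi d) (C.slice (Z \<omega>))" for t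
      using elim by (simp add: cdf_def C.kernel_def C.\<rho>.emeasure_eq_measure)
    moreover have "C.slice (Z \<omega>) \<inter> {..t} = {w. w \<le> t \<and> w \<in> C.slice (Z \<omega>)}" for t by auto
    ultimately show ?case by (simp add: fun_eq_iff cond_prob_def S)
  qed
  have "\<exists>\<kappa>. regular_cond_distr C.cond_measure C.sigma_Z T \<kappa>"
    using C.regular_cond_distr_kernel by blast
  moreover have "AE \<omega> in C.cond_measure. cdf (\<kappa> \<omega>) = (\<lambda>t. \<P>(w in chi d. w \<le> t \<bar> w \<in> truncation_set f \<sigma> E (X \<omega>)))"
    if "regular_cond_distr C.cond_measure C.sigma_Z T \<kappa>" for \<kappa>
    using C.AE_cdf_eq_kernel[OF that] cdf_kernel by eventually_elim simp
  moreover have "\<P>(\<omega> in M. 1 - cdf (\<kappa> \<omega>) (T \<omega>) \<le> \<alpha> \<bar> f (X \<omega>) = Some c) = \<alpha>"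
    if "regular_cond_distr C.cond_measure C.sigma_Z T \<kappa>" "0 < \<alpha>" "\<alpha> < 1" for \<kappa> \<alpha>
  proof -
    have "{\<omega> \<in> space M. 1 - cdf (\<kappa> \<omega>) (T \<omega>) \<le> \<alpha> \<and> \<omega> \<in> C.event} = {\<omega> \<in> space M. 1 - cdf (\<kappa> \<omega>) (T \<omega>) \<le> \<alpha> \<and> f (X \<omega>) = Some c}"
      by (auto simp: C.event_def mem_D)
    then show ?thesis
      using C.p_value_uniform[OF that(1) O.measure_chi_singleton[OF d] that(2,3)]
      by (simp add: cond_prob_def event_eq[folded f_def])
  qed
  ultimately show ?thesis
    unfolding Let_def E_def[symmetric] d_def[symmetric] f_def[symmetric] Z_eq T_eq
      T_def[symmetric] Z_def[symmetric] event_eq[folded f_def]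
    by blast
qed

end
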